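(* Let $m>n$ be relatively prime positive integers, and suppose that $m$ is neither an odd perfect cube nor twice a perfect cube. Let $r = n(m-n)$ and $s = m(m+n)$, and let $\mathcal{C}_{m,n}$ be the elliptic curve given by the projective closure of $$s(xy - r^2) = x^2 y + x y^2,$$ with group law on its points in which the identity is $[1,-1,0]$ and $P+Q$ is the reflection in the line $y=x$ of the third intersection point of the curve with the line through $P$ and $Q$ (tangent line if $P=Q$). Then the group $\mathcal{C}_{m,n}(\mathbb{Q})$ of rational points satisfies $$\operatorname{rank}_{\mathbb{Z}} \mathcal{C}_{m,n}(\mathbb{Q}) \geq 1 .$$
   Context: For such $m,n$, the numbers $m^2-n^2$, $2mn$, $m^2+n^2$ are the side lengths of a right triangle with inradius $r=n(m-n)$ and semiperimeter $s=m(m+n)$; since this triangle is not equilateral one has $s>3\sqrt{3}r>0$, so the cubic above is nonsingular. The rank of $\mathcal{C}_{m,n}(\mathbb{Q})$ is its rank as a finitely generated abelian group. *)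

theory Defs
  imports "HOL-Algebra.Group" "HOL-Algebra.FiniteProduct" "HOL-Library.Extended_Nat"
begin

type_synonym pt = "rat \<times> rat \<times> rat"

(* homogeneous cubic  F(X,Y,Z) = s(XYZ - r^2 Z^3) - X^2 Y - X Y^2,
   projective closure of s(xy - r^2) = x^2 y + x y^2 *)
fun cubF :: "rat \<Rightarrow> rat \<Rightarrow> pt \<Rightarrow> rat" where
  "cubF r s (X, Y, Z) = s * (X * Y * Z - r^2 * Z^3) - X^2 * Y - X * Y^2"

fun gradF :: "rat \<Rightarrow> rat \<Rightarrow> pt \<Rightarrow> pt" where
  "gradF r s (X, Y, Z) =
     (s * Y * Z - 2 * X * Y - Y^2, s * X * Z - X^2 - 2 * X * Y, s * X * Y - 3 * s * r^2 * Z^2)"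

fun dot3 :: "pt \<Rightarrow> pt \<Rightarrow> rat" where
  "dot3 (a, b, c) (x, y, z) = a * x + b * y + c * z"

fun cross3 :: "pt \<Rightarrow> pt \<Rightarrow> pt" where
  "cross3 (a, b, c) (x, y, z) = (b * z - c * y, c * x - a * z, a * y - b * x)"

fun scale3 :: "rat \<Rightarrow> pt \<Rightarrow> pt" where
  "scale3 k (x, y, z) = (k * x, k * y, k * z)"

fun sub3 :: "pt \<Rightarrow> pt \<Rightarrow> pt" where
  "sub3 (a, b, c) (x, y, z) = (a - x, b - y, c - z)"

fun refl_yx :: "pt \<Rightarrow> pt" where
  "refl_yx (x, y, z) = (y, x, z)"

definition proj :: "pt \<Rightarrow> pt set" where
  "proj v = {scale3 c v | c. c \<noteq> 0}"

(* For points A, B (distinct projectively) the restriction of F to the line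
   tA + uB is the binary cubic
     F(A) t^3 + (gradF(A).B) t^2 u + (gradF(B).A) t u^2 + F(B) u^3.
   Third intersection of the chord through P,Q (both on the curve, distinct):
   F(tP+uQ) = t u ((gradF(P).Q) t + (gradF(Q).P) u), so the third root is
   (t,u) = (gradF(Q).P, -(gradF(P).Q)). *)
definition chord_third :: "rat \<Rightarrow> rat \<Rightarrow> pt \<Rightarrow> pt \<Rightarrow> pt" where
  "chord_third r s P Q =
     sub3 (scale3 (dot3 (gradF r s Q) P) P) (scale3 (dot3 (gradF r s P) Q) Q)"

(* Third intersection of the tangent line at P: D = gradF(P) x P is a point of the
   tangent line not proportional to P; F(tP+uD) = u^2 ((gradF(D).P) t + F(D) u),
   so the third root is (t,u) = (F(D), -(gradF(D).P)). *)
definition tangent_third :: "rat \<Rightarrow> rat \<Rightarrow> pt \<Rightarrow> pt" where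
  "tangent_third r s P =
     (let D = cross3 (gradF r s P) P
      in sub3 (scale3 (cubF r s D) P) (scale3 (dot3 (gradF r s D) P) D))"

definition third_pt :: "rat \<Rightarrow> rat \<Rightarrow> pt \<Rightarrow> pt \<Rightarrow> pt" where
  "third_pt r s P Q = (if proj P = proj Q then tangent_third r s P else chord_third r s P Q)"

definition curve_group :: "nat \<Rightarrow> nat \<Rightarrow> pt set monoid" where
  "curve_group m n =
    (let r = rat_of_nat (n * (m - n)); s = rat_of_nat (m * (m + n)) in
     \<lparr> carrier = {proj v | v. v \<noteq> (0, 0, 0) \<and> cubF r s v = 0},
       mult = (\<lambda>A B. proj (refl_yx (third_pt r s (SOME v. v \<in> A) (SOME w. w \<in> B)))),
       one = proj (1, -1, 0) \<rparr>)"

definition Z_independent :: "('a, 'b) monoid_scheme \<Rightarrow> 'a set \<Rightarrow> bool" where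
  "Z_independent G S \<longleftrightarrow> finite S \<and> S \<subseteq> carrier G \<and>
     (\<forall>c :: 'a \<Rightarrow> int. finprod G (\<lambda>x. x [^]\<^bsub>G\<^esub> c x) S = \<one>\<^bsub>G\<^esub> \<longrightarrow> (\<forall>x\<in>S. c x = 0))"

definition Z_rank :: "('a, 'b) monoid_scheme \<Rightarrow> enat" where
  "Z_rank G = Sup {enat (card S) | S. Z_independent G S}"

end

theory Submission
  imports Defs "HOL-Computational_Algebra.Primes"
begin

text \<open>
  The rank is bounded below by following the multiples of one explicit point \<open>B\<close> \<open>p\<close>-adically; this
  needs neither associativity nor a classification of torsion. Let \<open>p\<close> be a prime divisor of \<open>s\<close>.
  The rational points \<open>[1, y, z]\<close> with \<open>y\<close>, \<open>z\<close> integral at \<open>p\<close> and \<open>y\<close> congruent to \<open>-1\<close> are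
  determined by \<open>z\<close>, are closed under the chord-tangent operation, and translation by \<open>B\<close> satisfies
  \<open>z(A + B) = z(A) + z(B) + s h(A)\<close> with \<open>h\<close> a Lipschitz function of \<open>z(A)\<close>. When \<open>z(B)\<close> is a unit and
  \<open>p^2\<close> divides \<open>s\<close>, an ultrametric induction shows that the \<open>k\<close>-th iterate of the translation moves
  \<open>z\<close> by exactly the size of \<open>k\<close>, so it has no fixed point. When only \<open>p\<close> divides \<open>s\<close> but \<open>p \<ge> 5\<close>, the
  same holds for the \<open>p\<close>-th iterate: modulo \<open>p\<close>, \<open>h\<close> is a cubic polynomial in \<open>z\<close>, and sums of cubic
  polynomials over a full residue system vanish. The point \<open>B = [n(m - n), n(m + n), 1]\<close> works for
  \<open>p\<close> dividing \<open>m\<close>, and \<open>B = [n(m - n), m(m - n), 1]\<close> for odd \<open>p\<close> dividing \<open>m + n\<close>. The only pairs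
  without a suitable \<open>p\<close> of this kind are \<open>(2, 1)\<close>, which is excluded since \<open>2\<close> is twice a cube, and
  \<open>(3, 1)\<close>, where \<open>B = [-3, -1, 1]\<close> works for \<open>p = 2\<close>.
\<close>

section \<open>Localization of the rationals at a prime\<close>

definition pint :: "nat \<Rightarrow> rat set" where
  "pint p = {x. \<exists>a b::int. \<not> int p dvd b \<and> x = of_int a / of_int b}"

definition punit :: "nat \<Rightarrow> rat \<Rightarrow> bool" where
  "punit p x \<longleftrightarrow> x \<noteq> 0 \<and> x \<in> pint p \<and> inverse x \<in> pint p"

locale localization =
  fixes p :: nat
  assumes prime_p: "prime p"
begin

lemma not_dvd_mult: "\<not> int p dvd a \<Longrightarrow> \<not> int p dvd b \<Longrightarrow> \<not> int p dvd a * b"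
  using prime_p by (meson prime_dvd_multD prime_nat_int_transfer)

lemma pintI: "\<not> int p dvd b \<Longrightarrow> of_int a / of_int b \<in> pint p"
  by (auto simp: pint_def)

lemma pint_of_int [simp, intro]: "of_int a \<in> pint p"
proof -
  have "\<not> int p dvd 1" using prime_p not_prime_unit by auto
  from pintI[OF this, of a] show ?thesis by simp
qed

lemma pint_of_nat [simp, intro]: "of_nat a \<in> pint p"
  using pint_of_int[of "int a"] by simp

lemma pint_0 [simp, intro]: "0 \<in> pint p" and pint_1 [simp, intro]: "1 \<in> pint p"
  and pint_numeral [simp, intro]: "numeral w \<in> pint p"
  using pint_of_int[of 0] pint_of_int[of 1] pint_of_int[of "numeral w"] by simp_all

lemma pint_add [intro!]:
  assumes "x \<in> pint p" "y \<in> pint p" shows "x + y \<in> pint p"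
proof -
  obtain a b c d where *: "\<not> int p dvd b" "x = of_int a / of_int b"
      "\<not> int p dvd d" "y = of_int c / of_int d"
    using assms by (auto simp: pint_def)
  have "b \<noteq> 0" "d \<noteq> 0" using * by auto
  then have "x + y = of_int (a * d + c * b) / of_int (b * d)"
    using * by (simp add: field_simps)
  then show ?thesis using not_dvd_mult[OF *(1,3)] pintI by metis
qed

lemma pint_mult [intro!]:
  assumes "x \<in> pint p" "y \<in> pint p" shows "x * y \<in> pint p"
proof -
  obtain a b c d where *: "\<not> int p dvd b" "x = of_int a / of_int b"
      "\<not> int p dvd d" "y = of_int c / of_int d"
    using assms by (auto simp: pint_def)
  then have "x * y = of_int (a * c) / of_int (b * d)" by simp
  then show ?thesis using not_dvd_mult[OF *(1,3)] pintI by metis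
qed

lemma pint_uminus [intro!]: "x \<in> pint p \<Longrightarrow> - x \<in> pint p"
  using pint_mult[OF pint_of_int[of "-1"], of x] by simp

lemma pint_diff [intro!]: "x \<in> pint p \<Longrightarrow> y \<in> pint p \<Longrightarrow> x - y \<in> pint p"
  using pint_add[of x "- y"] pint_uminus[of y] by simp

lemma pint_power [intro!]: "x \<in> pint p \<Longrightarrow> x ^ k \<in> pint p"
  by (induction k) auto

lemma punitD: "punit p x \<Longrightarrow> x \<in> pint p" "punit p x \<Longrightarrow> x \<noteq> 0" "punit p x \<Longrightarrow> inverse x \<in> pint p"
  by (auto simp: punit_def)

lemma punit_of_int: "\<not> int p dvd k \<Longrightarrow> punit p (of_int k)"
  using pintI[of k 1] by (auto simp: punit_def field_simps)

lemma punit_of_nat: "\<not> p dvd k \<Longrightarrow> punit p (of_nat k)"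
  using punit_of_int[of "int k"] by auto

lemma punit_mult: "punit p x \<Longrightarrow> punit p y \<Longrightarrow> punit p (x * y)"
  by (auto simp: punit_def)

lemma punit_inverse: "punit p x \<Longrightarrow> punit p (inverse x)"
  by (auto simp: punit_def)

lemma punit_divide: "punit p x \<Longrightarrow> punit p y \<Longrightarrow> punit p (x / y)"
  by (simp add: divide_inverse punit_mult punit_inverse)

lemma pint_divide: "x \<in> pint p \<Longrightarrow> punit p y \<Longrightarrow> x / y \<in> pint p"
  by (auto simp: divide_inverse punit_def)

lemma punit_uminus: "punit p x \<Longrightarrow> punit p (- x)"
  by (auto simp: punit_def)

text \<open>The localization is a local ring whose non-units are the multiples of \<open>p\<close>,
  so a change by a multiple of \<open>p\<close> preserves units. Concretely, the numerator of
  \<open>u\<close> is prime to \<open>p\<close> because it divides \<open>b * b'\<close>.\<close>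

lemma punit_add_mult:
  assumes "punit p u" "c \<in> pint p" shows "punit p (u + of_nat p * c)"
proof -
  obtain a b where ab: "\<not> int p dvd b" "u = of_int a / of_int b"
    using punitD(1)[OF assms(1)] by (auto simp: pint_def)
  obtain a' b' where ab': "\<not> int p dvd b'" "inverse u = of_int a' / of_int b'"
    using punitD(3)[OF assms(1)] by (auto simp: pint_def)
  obtain c' d where c: "\<not> int p dvd d" "c = of_int c' / of_int d"
    using assms(2) by (auto simp: pint_def)
  have nz: "b \<noteq> 0" "d \<noteq> 0" "b' \<noteq> 0" using ab c ab' by auto
  have "of_int (a * a') = (of_int (b * b') :: rat)"
    using ab ab' nz punitD(2)[OF assms(1)] by (auto simp: field_simps)
  then have "a * a' = b * b'" by (simp only: of_int_eq_iff)
  then have "\<not> int p dvd a" using not_dvd_mult[OF ab(1) ab'(1)] by (metis dvd_mult2)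
  then have "\<not> int p dvd a * d + int p * c' * b"
    using not_dvd_mult[OF _ c(1)] by (metis dvd_add_left_iff dvd_mult2 dvd_triv_left)
  moreover have "u + of_nat p * c = of_int (a * d + int p * c' * b) / of_int (b * d)"
    using nz unfolding ab(2) c(2) by (simp add: field_simps)
  ultimately show ?thesis
    using punit_divide[OF punit_of_int punit_of_int] not_dvd_mult[OF ab(1) c(1)] by metis
qed

lemma punit_neq_mult:
  assumes "punit p u" "c \<in> pint p" shows "u \<noteq> of_nat p * c"
  using punit_add_mult[OF assms(1) pint_uminus[OF assms(2)]] by (auto simp: punit_def)

text \<open>The closed forms have a factor \<open>q\<close> in the numerator and denominators 2, 6
  and 4, which are prime to \<open>p\<close> because \<open>5 \<le> p\<close>.\<close>

lemma dvd_power_sums: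
  assumes "5 \<le> p"
  shows "p dvd (\<Sum>i<p. i)" "p dvd (\<Sum>i<p. i ^ 2)" "p dvd (\<Sum>i<p. i ^ 3)"
proof -
  have "\<not> p dvd 2" "\<not> p dvd 3" using assms by (auto dest!: dvd_imp_le)
  then have cop: "coprime p 2" "coprime p 3" using prime_p prime_imp_coprime by blast+
  have 1: "2 * (\<Sum>i<q. i) = q * (q - 1)" for q :: nat
    by (induction q) (auto simp: algebra_simps split: nat_diff_split)
  have 2: "6 * (\<Sum>i<q. i ^ 2) = q * (q - 1) * (2 * q - 1)" for q :: nat
  proof (induction q)
    case (Suc q)
    then show ?case by (cases q) (auto simp: algebra_simps power2_eq_square)
  qed simp
  have 3: "4 * (\<Sum>i<q. i ^ 3) = q * (q * (q - 1)\<^sup>2)" for q :: nat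
  proof (induction q)
    case (Suc q)
    then show ?case by (cases q) (auto simp: algebra_simps power2_eq_square power3_eq_cube)
  qed simp
  have "p dvd 2 * (\<Sum>i<p. i)" "p dvd 6 * (\<Sum>i<p. i ^ 2)" "p dvd 4 * (\<Sum>i<p. i ^ 3)"
    unfolding 1 2 3 by (simp_all add: mult.assoc)
  moreover have "coprime p 2" "coprime p 6" "coprime p 4"
    using cop coprime_mult_right_iff[of p 2 3] coprime_mult_right_iff[of p 2 2] by simp_all
  ultimately show "p dvd (\<Sum>i<p. i)" "p dvd (\<Sum>i<p. i ^ 2)" "p dvd (\<Sum>i<p. i ^ 3)"
    by (metis coprime_dvd_mult_right_iff)+
qed

lemma p_pos [simp]: "0 < p"
  using prime_p prime_gt_0_nat by blast

end

section \<open>Lipschitz functions\<close>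

locale lipschitz = localization +
  fixes X :: "'a set" and \<zeta> :: "'a \<Rightarrow> rat"
  assumes zeta_pint: "x \<in> X \<Longrightarrow> \<zeta> x \<in> pint p"
begin

text \<open>The ultrametric bound |f x - f y| \<le> |\<zeta> x - \<zeta> y|, phrased as
  divisibility.\<close>

definition lip :: "('a \<Rightarrow> rat) \<Rightarrow> bool" where
  "lip f \<longleftrightarrow> (\<forall>x\<in>X. f x \<in> pint p) \<and>
     (\<forall>x\<in>X. \<forall>y\<in>X. \<exists>k\<in>pint p. f x - f y = (\<zeta> x - \<zeta> y) * k)"

text \<open>The quotient by \<open>p\<close> has to be Lipschitz, not just integral, because
  \<open>drift\<close> bounds differences of displacements.\<close>

definition lcong :: "('a \<Rightarrow> rat) \<Rightarrow> ('a \<Rightarrow> rat) \<Rightarrow> bool" where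
  "lcong f g \<longleftrightarrow> (\<exists>h. lip h \<and> (\<forall>x\<in>X. f x = g x + of_nat p * h x))"

lemma lip_pint: "lip f \<Longrightarrow> x \<in> X \<Longrightarrow> f x \<in> pint p"
  by (auto simp: lip_def)

lemma lipE:
  assumes "lip f" "x \<in> X" "y \<in> X"
  obtains k where "k \<in> pint p" "f x - f y = (\<zeta> x - \<zeta> y) * k"
  using assms unfolding lip_def by blast

lemma lip_const [intro]: "c \<in> pint p \<Longrightarrow> lip (\<lambda>_. c)"
  by (auto simp: lip_def)

lemma lip_zeta [intro]: "lip \<zeta>"
  by (auto simp: lip_def zeta_pint intro!: bexI[of _ 1])

lemma lip_cong: "lip f \<Longrightarrow> (\<And>x. x \<in> X \<Longrightarrow> f x = g x) \<Longrightarrow> lip g"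
  by (auto simp: lip_def)

lemma lip_add [intro!]:
  assumes "lip f" "lip g" shows "lip (\<lambda>x. f x + g x)"
  unfolding lip_def
proof (intro conjI ballI)
  fix x y assume xy: "x \<in> X" "y \<in> X"
  obtain k where k: "k \<in> pint p" "f x - f y = (\<zeta> x - \<zeta> y) * k" using lipE[OF assms(1) xy] .
  obtain l where l: "l \<in> pint p" "g x - g y = (\<zeta> x - \<zeta> y) * l" using lipE[OF assms(2) xy] .
  show "\<exists>k\<in>pint p. f x + g x - (f y + g y) = (\<zeta> x - \<zeta> y) * k"
    using k l by (intro bexI[of _ "k + l"]) (auto simp: algebra_simps)
qed (use assms in \<open>auto simp: lip_pint\<close>)

lemma lip_mult [intro!]:
  assumes "lip f" "lip g" shows "lip (\<lambda>x. f x * g x)"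
  unfolding lip_def
proof (intro conjI ballI)
  fix x y assume xy: "x \<in> X" "y \<in> X"
  obtain k where k: "k \<in> pint p" "f x - f y = (\<zeta> x - \<zeta> y) * k" using lipE[OF assms(1) xy] .
  obtain l where l: "l \<in> pint p" "g x - g y = (\<zeta> x - \<zeta> y) * l" using lipE[OF assms(2) xy] .
  have "f x * g x - f y * g y = (f x - f y) * g x + f y * (g x - g y)" by (simp add: algebra_simps)
  also have "\<dots> = (\<zeta> x - \<zeta> y) * (k * g x + f y * l)"
    unfolding k(2) l(2) by (simp add: algebra_simps)
  finally show "\<exists>k\<in>pint p. f x * g x - f y * g y = (\<zeta> x - \<zeta> y) * k"
    using k(1) l(1) lip_pint[OF assms(1) xy(2)] lip_pint[OF assms(2) xy(1)]
    by (intro bexI[of _ "k * g x + f y * l"]) auto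
qed (use assms in \<open>auto simp: lip_pint\<close>)

lemma lip_uminus [intro!]: "lip f \<Longrightarrow> lip (\<lambda>x. - f x)"
  using lip_mult[OF lip_const[of "-1"], of f] by auto

lemma lip_diff [intro!]: "lip f \<Longrightarrow> lip g \<Longrightarrow> lip (\<lambda>x. f x - g x)"
  using lip_add[OF _ lip_uminus[of g], of f] by simp

lemma lip_power [intro!]: "lip f \<Longrightarrow> lip (\<lambda>x. f x ^ k)"
  by (induction k) auto

lemma lip_sum [intro]: "(\<And>i. i \<in> I \<Longrightarrow> lip (f i)) \<Longrightarrow> lip (\<lambda>x. \<Sum>i\<in>I. f i x)"
  by (induction I rule: infinite_finite_induct) auto

lemma lip_divide [intro]:
  assumes "lip f" "lip g" "\<And>x. x \<in> X \<Longrightarrow> punit p (g x)" shows "lip (\<lambda>x. f x / g x)"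
proof -
  have "lip (\<lambda>x. inverse (g x))"
    unfolding lip_def
  proof (intro conjI ballI)
    fix x y assume xy: "x \<in> X" "y \<in> X"
    obtain l where l: "l \<in> pint p" "g x - g y = (\<zeta> x - \<zeta> y) * l" using lipE[OF assms(2) xy] .
    have "inverse (g x) - inverse (g y) = - (g x - g y) * inverse (g x) * inverse (g y)"
      using assms(3)[OF xy(1)] assms(3)[OF xy(2)] by (simp add: punit_def field_simps)
    also have "\<dots> = (\<zeta> x - \<zeta> y) * (- l * inverse (g x) * inverse (g y))"
      unfolding l(2) by (simp add: algebra_simps)
    finally show "\<exists>k\<in>pint p. inverse (g x) - inverse (g y) = (\<zeta> x - \<zeta> y) * k"
      using l xy assms by (intro bexI[of _ "- l * inverse (g x) * inverse (g y)"]) (auto simp: punit_def)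
  qed (use assms in \<open>auto simp: punit_def\<close>)
  then show ?thesis using lip_mult[OF assms(1)] by (auto simp: divide_inverse)
qed

lemma lip_comp:
  assumes "lip f" "g \<in> X \<rightarrow> X" "lip (\<lambda>x. \<zeta> (g x))" shows "lip (\<lambda>x. f (g x))"
  unfolding lip_def
proof (intro conjI ballI)
  fix x y assume xy: "x \<in> X" "y \<in> X"
  have gxy: "g x \<in> X" "g y \<in> X" using xy assms(2) by auto
  obtain k where k: "k \<in> pint p" "f (g x) - f (g y) = (\<zeta> (g x) - \<zeta> (g y)) * k"
    using lipE[OF assms(1) gxy] .
  obtain l where l: "l \<in> pint p" "\<zeta> (g x) - \<zeta> (g y) = (\<zeta> x - \<zeta> y) * l" using lipE[OF assms(3) xy] .
  show "\<exists>k\<in>pint p. f (g x) - f (g y) = (\<zeta> x - \<zeta> y) * k"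
    using k l by (intro bexI[of _ "l * k"]) auto
qed (use assms lip_pint[OF assms(1)] in auto)

lemma lcongI: "lip h \<Longrightarrow> (\<And>x. x \<in> X \<Longrightarrow> f x = g x + of_nat p * h x) \<Longrightarrow> lcong f g"
  by (auto simp: lcong_def)

lemma lcongE:
  assumes "lcong f g"
  obtains h where "lip h" "\<And>x. x \<in> X \<Longrightarrow> f x = g x + of_nat p * h x"
  using assms by (auto simp: lcong_def)

lemma lcong_refl: "lcong f f"
  by (rule lcongI[of "\<lambda>_. 0"]) auto

lemma lcong_add:
  assumes "lcong f f'" "lcong g g'" shows "lcong (\<lambda>x. f x + g x) (\<lambda>x. f' x + g' x)"
proof -
  obtain h k where "lip h" "\<And>x. x \<in> X \<Longrightarrow> f x = f' x + of_nat p * h x"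
    "lip k" "\<And>x. x \<in> X \<Longrightarrow> g x = g' x + of_nat p * k x"
    using assms by (metis lcongE)
  then show ?thesis by (intro lcongI[of "\<lambda>x. h x + k x"]) (auto simp: algebra_simps)
qed

lemma lcong_mult:
  assumes "lcong f f'" "lcong g g'" "lip f" "lip g'"
  shows "lcong (\<lambda>x. f x * g x) (\<lambda>x. f' x * g' x)"
proof -
  obtain h where h: "lip h" "\<And>x. x \<in> X \<Longrightarrow> f x = f' x + of_nat p * h x"
    using assms by (metis lcongE)
  obtain k where k: "lip k" "\<And>x. x \<in> X \<Longrightarrow> g x = g' x + of_nat p * k x"
    using assms by (metis lcongE)
  show ?thesis
  proof (rule lcongI[of "\<lambda>x. f x * k x + h x * g' x"])
    show "lip (\<lambda>x. f x * k x + h x * g' x)" using assms h k by auto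
  next
    fix x assume "x \<in> X"
    show "f x * g x = f' x * g' x + of_nat p * (f x * k x + h x * g' x)"
      unfolding k(2)[OF \<open>x \<in> X\<close>] by (simp add: h(2)[OF \<open>x \<in> X\<close>] algebra_simps)
  qed
qed

lemma lcong_lip: "lcong f g \<Longrightarrow> lip g \<Longrightarrow> lip f"
  by (erule lcongE, rule lip_cong[OF lip_add[OF _ lip_mult[OF lip_const]]]) auto

lemma lcong_sum: "(\<And>i. i \<in> I \<Longrightarrow> lcong (f i) (g i)) \<Longrightarrow> lcong (\<lambda>x. \<Sum>i\<in>I. f i x) (\<lambda>x. \<Sum>i\<in>I. g i x)"
  by (induction I rule: infinite_finite_induct) (auto intro: lcong_refl lcong_add)

lemma lcong_trans:
  assumes "lcong f g" "lcong g h" shows "lcong f h"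
proof -
  obtain a where a: "lip a" "\<And>x. x \<in> X \<Longrightarrow> f x = g x + of_nat p * a x"
    using assms by (metis lcongE)
  obtain b where b: "lip b" "\<And>x. x \<in> X \<Longrightarrow> g x = h x + of_nat p * b x"
    using assms by (metis lcongE)
  show ?thesis
    using a b by (intro lcongI[of "\<lambda>x. a x + b x"]) (auto simp: algebra_simps)
qed

lemma lcong_power: "lcong f g \<Longrightarrow> lip g \<Longrightarrow> lcong (\<lambda>x. f x ^ k) (\<lambda>x. g x ^ k)"
  by (induction k) (auto intro: lcong_refl lcong_mult lcong_lip)

lemma lcong_const_mult: "lcong f g \<Longrightarrow> lip g \<Longrightarrow> c \<in> pint p \<Longrightarrow> lcong (\<lambda>x. c * f x) (\<lambda>x. c * g x)"
  by (rule lcong_mult[OF lcong_refl]) auto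

lemma lcong_diff:
  assumes "lcong f f'" "lcong g g'" shows "lcong (\<lambda>x. f x - g x) (\<lambda>x. f' x - g' x)"
proof -
  obtain h k where "lip h" "\<And>x. x \<in> X \<Longrightarrow> f x = f' x + of_nat p * h x"
    "lip k" "\<And>x. x \<in> X \<Longrightarrow> g x = g' x + of_nat p * k x"
    using assms by (metis lcongE)
  then show ?thesis by (intro lcongI[of "\<lambda>x. h x - k x"]) (auto simp: algebra_simps)
qed

lemma lcong_eq: "lcong f g \<Longrightarrow> (\<And>x. g x = h x) \<Longrightarrow> lcong f h"
  by (simp add: lcong_def)

text \<open>The denominators in the chord formulas are all congruent to \<open>-1\<close>, so modulo
  \<open>p\<close> dividing by them is a change of sign.\<close>

lemma lcong_divide_minus_one:
  assumes "lcong f f'" "lip f'" "lip g" "\<And>x. x \<in> X \<Longrightarrow> punit p (g x)" "lcong g (\<lambda>_. - 1)"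
  shows "lcong (\<lambda>x. f x / g x) (\<lambda>x. - f' x)"
proof -
  obtain a where a: "lip a" "\<And>x. x \<in> X \<Longrightarrow> f x = f' x + of_nat p * a x"
    using lcongE[OF assms(1)] by metis
  obtain b where b: "lip b" "\<And>x. x \<in> X \<Longrightarrow> g x = - 1 + of_nat p * b x"
    using lcongE[OF assms(5)] by metis
  show ?thesis
  proof (rule lcongI[of "\<lambda>x. (a x + f' x * b x) / g x"])
    show "lip (\<lambda>x. (a x + f' x * b x) / g x)" using a b assms by auto
  next
    fix x assume x: "x \<in> X"
    have "g x \<noteq> 0" using assms(4)[OF x] by (simp add: punit_def)
    then show "f x / g x = - f' x + of_nat p * ((a x + f' x * b x) / g x)"
      using a(2)[OF x] b(2)[OF x] by (simp add: divide_simps) (simp add: algebra_simps)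
  qed
qed

section \<open>Maps without periodic points\<close>

text \<open>Every point moves by exactly the \<open>p\<close>-adic size of \<open>e\<close>, and the
  displacement varies slowly with the point. The exponent 2 leaves a spare factor \<open>p\<close>
  when \<open>g\<close> is replaced by its \<open>p\<close>-th iterate.\<close>

definition drift :: "('a \<Rightarrow> 'a) \<Rightarrow> rat \<Rightarrow> bool" where
  "drift g e \<longleftrightarrow> g \<in> X \<rightarrow> X \<and> e \<noteq> 0 \<and>
     (\<forall>x\<in>X. \<exists>u. punit p u \<and> \<zeta> (g x) - \<zeta> x = e * u) \<and>
     (\<forall>x\<in>X. \<forall>y\<in>X. \<exists>k\<in>pint p.
        (\<zeta> (g x) - \<zeta> x) - (\<zeta> (g y) - \<zeta> y) = of_nat p ^ 2 * (\<zeta> x - \<zeta> y) * k)"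

lemma drift_funpow_mem: "drift g e \<Longrightarrow> x \<in> X \<Longrightarrow> (g ^^ n) x \<in> X"
  by (induction n) (auto simp: drift_def)

text \<open>Telescoping: each further step repeats the first displacement up to \<open>p^2\<close>
  times the distance travelled so far, which is itself a multiple of \<open>e\<close>.\<close>

lemma drift_funpow:
  assumes "drift g e" "x \<in> X"
  shows "\<exists>c\<in>pint p. \<zeta> ((g ^^ n) x) - \<zeta> x = of_nat n * (\<zeta> (g x) - \<zeta> x) + of_nat p ^ 2 * e * c"
proof (induction n)
  case 0
  then show ?case by (auto intro: bexI[of _ 0])
next
  case (Suc n)
  obtain c where c: "c \<in> pint p"
    "\<zeta> ((g ^^ n) x) - \<zeta> x = of_nat n * (\<zeta> (g x) - \<zeta> x) + of_nat p ^ 2 * e * c"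
    using Suc by blast
  obtain u where u: "punit p u" "\<zeta> (g x) - \<zeta> x = e * u"
    using assms unfolding drift_def by blast
  let ?y = "(g ^^ n) x"
  obtain k where k: "k \<in> pint p"
    "(\<zeta> (g ?y) - \<zeta> ?y) - (\<zeta> (g x) - \<zeta> x) = of_nat p ^ 2 * (\<zeta> ?y - \<zeta> x) * k"
    using assms drift_funpow_mem[OF assms] unfolding drift_def by blast
  have s: "\<zeta> ((g ^^ Suc n) x) - \<zeta> x
      = ((\<zeta> (g ?y) - \<zeta> ?y) - (\<zeta> (g x) - \<zeta> x)) + (\<zeta> ?y - \<zeta> x) + (\<zeta> (g x) - \<zeta> x)"
    by simp
  have "\<zeta> ((g ^^ Suc n) x) - \<zeta> x = of_nat (Suc n) * (\<zeta> (g x) - \<zeta> x)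
      + of_nat p ^ 2 * e * ((of_nat n * u + of_nat p ^ 2 * c) * k + c)"
    unfolding s unfolding k(2) unfolding c(2) unfolding u(2) by (simp add: algebra_simps)
  then show ?case
    using c(1) k(1) punitD(1)[OF u(1)]
    by (intro bexI[of _ "(of_nat n * u + of_nat p ^ 2 * c) * k + c"]) auto
qed

lemma drift_funpow_lipschitz:
  assumes "drift g e" "x \<in> X" "y \<in> X"
  shows "\<exists>k\<in>pint p. (\<zeta> ((g ^^ n) x) - \<zeta> x) - (\<zeta> ((g ^^ n) y) - \<zeta> y)
    = of_nat p ^ 2 * (\<zeta> x - \<zeta> y) * k"
proof (induction n)
  case 0
  then show ?case by (auto intro: bexI[of _ 0])
next
  case (Suc n)
  let ?x = "(g ^^ n) x" and ?y = "(g ^^ n) y"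
  obtain c where c: "c \<in> pint p"
    "(\<zeta> ?x - \<zeta> x) - (\<zeta> ?y - \<zeta> y) = of_nat p ^ 2 * (\<zeta> x - \<zeta> y) * c"
    using Suc by blast
  obtain k where k: "k \<in> pint p"
    "(\<zeta> (g ?x) - \<zeta> ?x) - (\<zeta> (g ?y) - \<zeta> ?y) = of_nat p ^ 2 * (\<zeta> ?x - \<zeta> ?y) * k"
    using assms drift_funpow_mem[OF assms(1)] unfolding drift_def by blast
  have d: "\<zeta> ?x - \<zeta> ?y = (\<zeta> x - \<zeta> y) * (1 + of_nat p ^ 2 * c)"
    using c(2) by (simp add: algebra_simps)
  have "(\<zeta> ((g ^^ Suc n) x) - \<zeta> x) - (\<zeta> ((g ^^ Suc n) y) - \<zeta> y)
      = ((\<zeta> (g ?x) - \<zeta> ?x) - (\<zeta> (g ?y) - \<zeta> ?y)) + ((\<zeta> ?x - \<zeta> x) - (\<zeta> ?y - \<zeta> y))"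
    by simp
  also have "\<dots> = of_nat p ^ 2 * (\<zeta> x - \<zeta> y) * ((1 + of_nat p ^ 2 * c) * k + c)"
    unfolding k(2) c(2) d by (simp add: algebra_simps)
  finally show ?case
    using c(1) k(1) by (intro bexI[of _ "(1 + of_nat p ^ 2 * c) * k + c"]) auto
qed

text \<open>The main term is \<open>p * e * u\<close> and the error \<open>p^2 * e * c\<close>;
  pulling out \<open>p * e\<close> leaves the unit \<open>u + p * c\<close>.\<close>

lemma drift_funpow_p:
  assumes "drift g e" shows "drift (g ^^ p) (of_nat p * e)"
  unfolding drift_def
proof (intro conjI ballI)
  fix x assume x: "x \<in> X"
  obtain c where c: "c \<in> pint p"
    "\<zeta> ((g ^^ p) x) - \<zeta> x = of_nat p * (\<zeta> (g x) - \<zeta> x) + of_nat p ^ 2 * e * c"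
    using drift_funpow[OF assms x] by blast
  obtain u where u: "punit p u" "\<zeta> (g x) - \<zeta> x = e * u"
    using assms x unfolding drift_def by blast
  have "\<zeta> ((g ^^ p) x) - \<zeta> x = of_nat p * e * (u + of_nat p * c)"
    unfolding c(2) u(2) by (simp add: algebra_simps power2_eq_square)
  then show "\<exists>u. punit p u \<and> \<zeta> ((g ^^ p) x) - \<zeta> x = of_nat p * e * u"
    using punit_add_mult[OF u(1) c(1)] by blast
next
  show "of_nat p * e \<noteq> 0" using assms by (simp add: drift_def)
next
  show "g ^^ p \<in> X \<rightarrow> X" using drift_funpow_mem[OF assms] by blast
qed (use drift_funpow_lipschitz[OF assms] in blast)

text \<open>Factors \<open>p\<close> of \<open>n\<close> are removed one at a time by passing from
  \<open>g\<close> to \<open>g ^^ p\<close>. Once \<open>p\<close> does not divide \<open>n\<close>,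
  the displacement is \<open>e\<close> times a unit congruent to \<open>n * u\<close>.\<close>

theorem drift_no_periodic_point:
  assumes "drift g e" "x \<in> X" "0 < n"
  shows "(g ^^ n) x \<noteq> x"
  using assms
proof (induction n arbitrary: g e rule: less_induct)
  case (less n)
  show ?case
  proof (cases "p dvd n")
    case True
    then obtain m where m: "n = p * m" by blast
    have "1 < p" using prime_p prime_gt_1_nat by blast
    then have "m < n" "0 < m" using m \<open>0 < n\<close> by auto
    from less.IH[OF this(1) drift_funpow_p[OF less.prems(1)] \<open>x \<in> X\<close> this(2)]
    show ?thesis by (simp add: m funpow_mult)
  next
    case False
    obtain c where c: "c \<in> pint p"
      "\<zeta> ((g ^^ n) x) - \<zeta> x = of_nat n * (\<zeta> (g x) - \<zeta> x) + of_nat p ^ 2 * e * c"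
      using drift_funpow[OF less.prems(1,2)] by blast
    obtain u where u: "punit p u" "\<zeta> (g x) - \<zeta> x = e * u"
      using less.prems unfolding drift_def by blast
    have "\<zeta> ((g ^^ n) x) - \<zeta> x = e * (of_nat n * u + of_nat p * (of_nat p * c))"
      unfolding c(2) u(2) by (simp add: algebra_simps power2_eq_square)
    moreover have "punit p (of_nat n * u + of_nat p * (of_nat p * c))"
      using punit_add_mult[OF punit_mult[OF punit_of_nat[OF False] u(1)]] c(1) by blast
    ultimately show ?thesis
      using less.prems(1) by (auto simp: drift_def punit_def)
  qed
qed

text \<open>The equation \<open>e * k = of_nat p\<close> says that \<open>e\<close> divides
  \<open>p\<close>, so the term \<open>p^2 * h x\<close> alters \<open>b\<close> only modulo
  \<open>p\<close>. The cases needed are \<open>e = 1\<close> and \<open>e = p\<close>.\<close>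

lemma driftI:
  assumes "g \<in> X \<rightarrow> X" "punit p b" "e \<noteq> 0" "lip h" "k \<in> pint p" "e * k = of_nat p"
    and "\<And>x. x \<in> X \<Longrightarrow> \<zeta> (g x) = \<zeta> x + e * b + of_nat p ^ 2 * h x"
  shows "drift g e"
  unfolding drift_def
proof (intro conjI ballI)
  fix x assume x: "x \<in> X"
  have "\<zeta> (g x) - \<zeta> x = e * (b + of_nat p * (k * h x))"
    using assms(7)[OF x] assms(6)[symmetric] by (simp add: algebra_simps power2_eq_square)
  moreover have "punit p (b + of_nat p * (k * h x))"
    using punit_add_mult[OF assms(2)] assms(5) lip_pint[OF assms(4) x] by blast
  ultimately show "\<exists>u. punit p u \<and> \<zeta> (g x) - \<zeta> x = e * u" by blast
next
  fix x y assume xy: "x \<in> X" "y \<in> X"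
  obtain l where l: "l \<in> pint p" "h x - h y = (\<zeta> x - \<zeta> y) * l" using lipE[OF assms(4) xy] .
  have "(\<zeta> (g x) - \<zeta> x) - (\<zeta> (g y) - \<zeta> y) = of_nat p ^ 2 * (h x - h y)"
    using assms(7) xy by (simp add: algebra_simps)
  then show "\<exists>k\<in>pint p. (\<zeta> (g x) - \<zeta> x) - (\<zeta> (g y) - \<zeta> y) = of_nat p ^ 2 * (\<zeta> x - \<zeta> y) * k"
    using l by (intro bexI[of _ l]) auto
qed (use assms in auto)

text \<open>The error of \<open>g\<close> itself has only one factor \<open>p\<close>. Modulo
  \<open>p\<close> the iterates run through an arithmetic progression with unit step
  \<open>b\<close>, so over \<open>p\<close> steps the errors add up to a cubic summed over a full
  residue system. That sum vanishes modulo \<open>p\<close> and supplies the second factor.\<close>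

lemma drift_funpow_of_cubic:
  assumes g: "g \<in> X \<rightarrow> X" and b: "punit p b" and s: "s \<in> pint p" and p5: "5 \<le> p"
    and c: "c1 \<in> pint p" "c2 \<in> pint p" "c3 \<in> pint p"
    and q: "lcong h (\<lambda>x. c1 * \<zeta> x + c2 * \<zeta> x ^ 2 + c3 * \<zeta> x ^ 3)"
    and gh: "\<And>x. x \<in> X \<Longrightarrow> \<zeta> (g x) = \<zeta> x + b + of_nat p * s * h x"
  shows "drift (g ^^ p) (of_nat p)"
proof -
  have bp: "b \<in> pint p" using b by (simp add: punit_def)
  have lh: "lip h" by (rule lcong_lip[OF q]) (use c in auto)
  have gi: "g ^^ i \<in> X \<rightarrow> X" for i using g by (induction i) auto
  have "lip (\<lambda>x. \<zeta> x + b + of_nat p * s * h x)" using lh bp s by auto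
  then have lg: "lip (\<lambda>x. \<zeta> (g x))" by (rule lip_cong) (simp add: gh)
  have lgi: "lip (\<lambda>x. \<zeta> ((g ^^ i) x))" for i
  proof (induction i)
    case (Suc i)
    show ?case using lip_comp[OF lg gi Suc] by simp
  qed (auto intro: lip_zeta)
  have lhi: "lip (\<lambda>x. h ((g ^^ i) x))" for i by (rule lip_comp[OF lh gi lgi])
  have step: "\<zeta> ((g ^^ i) x) = \<zeta> x + of_nat i * b + of_nat p * s * (\<Sum>j<i. h ((g ^^ j) x))"
    if "x \<in> X" for i x
    using that
  proof (induction i)
    case (Suc i)
    have "(g ^^ i) x \<in> X" using gi Suc.prems by auto
    from gh[OF this] show ?case using Suc by (simp add: algebra_simps)
  qed simp
  define Q where "Q t = c1 * t + c2 * t ^ 2 + c3 * t ^ 3" for t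
  define R where "R x = (\<Sum>i<p. Q (\<zeta> x + of_nat i * b))" for x
  have zi: "lcong (\<lambda>x. \<zeta> ((g ^^ i) x)) (\<lambda>x. \<zeta> x + of_nat i * b)" for i
    by (rule lcongI[of "\<lambda>x. s * (\<Sum>j<i. h ((g ^^ j) x))"]) (use lhi s step in \<open>auto simp: mult.assoc\<close>)
  have hi: "lcong (\<lambda>x. h ((g ^^ i) x)) (\<lambda>x. Q (\<zeta> x + of_nat i * b))" for i
  proof (rule lcong_trans)
    obtain a where a: "lip a" "\<And>x. x \<in> X \<Longrightarrow> h x = Q (\<zeta> x) + of_nat p * a x"
      using lcongE[OF q] unfolding Q_def by metis
    show "lcong (\<lambda>x. h ((g ^^ i) x)) (\<lambda>x. Q (\<zeta> ((g ^^ i) x)))"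
      by (rule lcongI[OF lip_comp[OF a(1) gi lgi]]) (use gi in \<open>auto intro!: a\<close>)
    show "lcong (\<lambda>x. Q (\<zeta> ((g ^^ i) x))) (\<lambda>x. Q (\<zeta> x + of_nat i * b))"
      unfolding Q_def using zi bp c by (intro lcong_add lcong_const_mult lcong_power) auto
  qed
  have R: "lcong R (\<lambda>_. 0)"
  proof -
    obtain a1 a2 a3 where a: "(\<Sum>i<p. i) = p * a1" "(\<Sum>i<p. i ^ 2) = p * a2" "(\<Sum>i<p. i ^ 3) = p * a3"
      using dvd_power_sums[OF p5] by (metis dvdE)
    have a': "(\<Sum>i<p. of_nat i) = (of_nat (p * a1) :: rat)" "(\<Sum>i<p. of_nat i ^ 2) = (of_nat (p * a2) :: rat)"
      "(\<Sum>i<p. of_nat i ^ 3) = (of_nat (p * a3) :: rat)"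
      unfolding a[symmetric] by simp_all
    \<comment> \<open>\<open>w\<close> is \<open>R\<close> divided by \<open>p\<close>: expand
      \<open>Q (t + i * b)\<close> in powers of \<open>i\<close> and replace the three power sums by
      \<open>p * a1\<close>, \<open>p * a2\<close>, \<open>p * a3\<close>.\<close>
    define w where "w t = c1 * t + c1 * b * of_nat a1
       + c2 * t ^ 2 + 2 * c2 * b * t * of_nat a1 + c2 * b ^ 2 * of_nat a2
       + c3 * t ^ 3 + 3 * c3 * b * t ^ 2 * of_nat a1 + 3 * c3 * b ^ 2 * t * of_nat a2
       + c3 * b ^ 3 * of_nat a3" for t
    have "R x = of_nat p * w (\<zeta> x)" for x
    proof -
      let ?t = "\<zeta> x"
      have "Q (?t + of_nat i * b) = (c1 * ?t + c2 * ?t ^ 2 + c3 * ?t ^ 3)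
          + (c1 * b + 2 * c2 * b * ?t + 3 * c3 * b * ?t ^ 2) * of_nat i
          + (c2 * b ^ 2 + 3 * c3 * b ^ 2 * ?t) * of_nat i ^ 2 + c3 * b ^ 3 * of_nat i ^ 3" for i
        unfolding Q_def by algebra
      then have "R x = of_nat p * (c1 * ?t + c2 * ?t ^ 2 + c3 * ?t ^ 3)
          + (c1 * b + 2 * c2 * b * ?t + 3 * c3 * b * ?t ^ 2) * (\<Sum>i<p. of_nat i)
          + (c2 * b ^ 2 + 3 * c3 * b ^ 2 * ?t) * (\<Sum>i<p. of_nat i ^ 2) + c3 * b ^ 3 * (\<Sum>i<p. of_nat i ^ 3)"
        unfolding R_def by (simp add: sum.distrib sum_distrib_left)
      then show ?thesis unfolding a' w_def by (simp add: algebra_simps)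
    qed
    moreover have "lip (\<lambda>x. w (\<zeta> x))" unfolding w_def
      using c bp by (intro lip_add lip_mult lip_power lip_const lip_zeta) auto
    ultimately show ?thesis by (intro lcongI[of "\<lambda>x. w (\<zeta> x)"]) auto
  qed
  have "lcong (\<lambda>x. \<Sum>i<p. h ((g ^^ i) x)) R"
    unfolding R_def by (rule lcong_sum) (rule hi)
  from lcong_trans[OF this R]
  obtain a where a: "lip a" "\<And>x. x \<in> X \<Longrightarrow> (\<Sum>i<p. h ((g ^^ i) x)) = of_nat p * a x"
    by (auto elim: lcongE)
  show ?thesis
  proof (rule driftI[OF gi b, where k = 1])
    show "lip (\<lambda>x. s * a x)" using a s by auto
    show "\<zeta> ((g ^^ p) x) = \<zeta> x + of_nat p * b + of_nat p ^ 2 * (s * a x)" if "x \<in> X" for x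
      using step[OF that, of p] a(2)[OF that] by (simp add: power2_eq_square)
  qed auto
qed

end

section \<open>Chords and tangents in projective coordinates\<close>

lemma scale3_scale3: "scale3 a (scale3 b v) = scale3 (a * b) v"
  by (cases v) auto

lemma scale3_1 [simp]: "scale3 1 v = v"
  by (cases v) auto

lemma proj_self: "v \<in> proj v"
  unfolding proj_def by (auto intro: exI[of _ 1])

lemma proj_scale3 [simp]:
  assumes "c \<noteq> 0" shows "proj (scale3 c v) = proj v"
proof (intro equalityI subsetI)
  fix w assume "w \<in> proj (scale3 c v)"
  then show "w \<in> proj v" using assms by (auto simp: proj_def scale3_scale3)
next
  fix w assume "w \<in> proj v"
  then obtain d where d: "d \<noteq> 0" "w = scale3 d v" by (auto simp: proj_def)
  have "w = scale3 (d / c) (scale3 c v)" using assms by (simp add: d scale3_scale3)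
  moreover have "d / c \<noteq> 0" using d assms by simp
  ultimately show "w \<in> proj (scale3 c v)" unfolding proj_def by blast
qed

lemma proj_eq_iff: "proj v = proj w \<longleftrightarrow> (\<exists>c. c \<noteq> 0 \<and> v = scale3 c w)"
  using proj_self[of v] by (auto simp: proj_def[of w])

lemma some_proj:
  obtains c where "c \<noteq> 0" "(SOME w. w \<in> proj v) = scale3 c v"
  using someI[of "\<lambda>w. w \<in> proj v", OF proj_self] by (auto simp: proj_def)

lemma cubF_scale3: "cubF r s (scale3 c v) = c ^ 3 * cubF r s v"
  by (cases v) (simp add: algebra_simps power2_eq_square power3_eq_cube)

lemma gradF_scale3: "gradF r s (scale3 c v) = scale3 (c ^ 2) (gradF r s v)"
  by (cases v) (simp add: algebra_simps power2_eq_square power3_eq_cube)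

lemma dot3_scale3: "dot3 (scale3 a v) (scale3 b w) = a * b * dot3 v w"
  by (cases v; cases w) (simp add: algebra_simps)

lemma cross3_scale3: "cross3 (scale3 a v) (scale3 b w) = scale3 (a * b) (cross3 v w)"
  by (cases v; cases w) (simp add: algebra_simps)

lemma sub3_scale3: "sub3 (scale3 a v) (scale3 a w) = scale3 a (sub3 v w)"
  by (cases v; cases w) (simp add: algebra_simps)

lemma refl_yx_scale3: "refl_yx (scale3 c v) = scale3 c (refl_yx v)"
  by (cases v) simp

lemma refl_yx_refl_yx [simp]: "refl_yx (refl_yx v) = v"
  by (cases v) simp

lemma cubF_refl_yx [simp]: "cubF r s (refl_yx v) = cubF r s v"
  by (cases v) (simp add: algebra_simps)

lemma chord_third_scale3:
  "chord_third r s (scale3 a v) (scale3 b w) = scale3 (a ^ 2 * b ^ 2) (chord_third r s v w)"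
proof -
  have "chord_third r s (scale3 a v) (scale3 b w)
     = sub3 (scale3 (a ^ 2 * b ^ 2) (scale3 (dot3 (gradF r s w) v) v))
            (scale3 (a ^ 2 * b ^ 2) (scale3 (dot3 (gradF r s v) w) w))"
    unfolding chord_third_def gradF_scale3 dot3_scale3 scale3_scale3
    by (simp add: ac_simps power2_eq_square)
  then show ?thesis unfolding sub3_scale3 chord_third_def .
qed

text \<open>The exponent is a degree count: \<open>D\<close> has degree 3 in \<open>v\<close>, so
  the two terms have degrees 9 + 1 and 6 + 1 + 3.\<close>

lemma tangent_third_scale3:
  "tangent_third r s (scale3 a v) = scale3 (a ^ 10) (tangent_third r s v)"
proof -
  define D where "D = cross3 (gradF r s v) v"
  have D: "cross3 (gradF r s (scale3 a v)) (scale3 a v) = scale3 (a ^ 3) D"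
    by (simp add: gradF_scale3 cross3_scale3 D_def power2_eq_square power3_eq_cube)
  have "tangent_third r s (scale3 a v)
     = sub3 (scale3 (a ^ 10) (scale3 (cubF r s D) v))
            (scale3 (a ^ 10) (scale3 (dot3 (gradF r s D) v) D))"
    unfolding tangent_third_def Let_def unfolding D unfolding gradF_scale3 dot3_scale3 scale3_scale3 cubF_scale3
    by (simp add: eval_nat_numeral ac_simps)
  then show ?thesis unfolding sub3_scale3 tangent_third_def D_def Let_def .
qed

lemma third_pt_scale3:
  assumes "a \<noteq> 0" "b \<noteq> 0"
  obtains c where "c \<noteq> 0" "third_pt r s (scale3 a v) (scale3 b w) = scale3 c (third_pt r s v w)"
proof -
  have "third_pt r s (scale3 a v) (scale3 b w)
      = scale3 (if proj v = proj w then a ^ 10 else a ^ 2 * b ^ 2) (third_pt r s v w)"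
    using assms by (simp add: third_pt_def tangent_third_scale3 chord_third_scale3)
  then show ?thesis using assms by (intro that) auto
qed

lemma cubF_line:
  "cubF r s (sub3 (scale3 t v) (scale3 u w))
    = t ^ 3 * cubF r s v - t ^ 2 * u * dot3 (gradF r s v) w
      + t * u ^ 2 * dot3 (gradF r s w) v - u ^ 3 * cubF r s w"
  by (cases v; cases w) (simp add: algebra_simps power2_eq_square power3_eq_cube)

text \<open>The derivative of \<open>cubF_line\<close> with respect to \<open>t\<close>.\<close>

lemma gradF_line:
  "dot3 (gradF r s (sub3 (scale3 t v) (scale3 u w))) v
    = 3 * t ^ 2 * cubF r s v - 2 * t * u * dot3 (gradF r s v) w + u ^ 2 * dot3 (gradF r s w) v"
  by (cases v; cases w) (simp add: algebra_simps power2_eq_square power3_eq_cube)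

lemma cubF_chord_third:
  "cubF r s v = 0 \<Longrightarrow> cubF r s w = 0 \<Longrightarrow> cubF r s (chord_third r s v w) = 0"
  unfolding chord_third_def cubF_line by (simp add: power2_eq_square)

lemma cubF_tangent_third:
  assumes "cubF r s v = 0" shows "cubF r s (tangent_third r s v) = 0"
proof -
  have "dot3 g (cross3 g v) = 0" for g
    by (cases g; cases v) (simp add: algebra_simps)
  then show ?thesis unfolding tangent_third_def Let_def cubF_line
    by (simp add: assms power2_eq_square power3_eq_cube)
qed

text \<open>In the chart \<open>X = 1\<close>, substituting \<open>y = y1 + l * (z - z1)\<close>
  gives a cubic in \<open>z\<close> with leading coefficients \<open>- s * r ^ 2\<close> and
  \<open>s * l - l ^ 2\<close>; the hypothesis on \<open>z3\<close> is Vieta's formula for the sum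
  of its roots.\<close>

lemma chord_third_affine:
  assumes P: "cubF r s (1, y1, z1) = 0" and Q: "cubF r s (1, y2, z2) = 0"
    and l: "y2 - y1 = l * (z2 - z1)"
    and z3: "s * r ^ 2 * (z1 + z2 + z3) = s * l - l ^ 2" and y3: "y3 = y1 + l * (z3 - z1)"
  shows "chord_third r s (1, y1, z1) (1, y2, z2) = scale3 (s * r ^ 2 * (z2 - z1) ^ 3) (1, y3, z3)"
proof -
  define \<alpha> where "\<alpha> = dot3 (gradF r s (1, y2, z2)) (1, y1, z1)"
  define \<beta> where "\<beta> = dot3 (gradF r s (1, y1, z1)) (1, y2, z2)"
  define d where "d = z2 - z1"
  define k where "k = s * r ^ 2 * (z2 - z1) ^ 3"
  have y2: "y2 = y1 + l * d" and z2: "z2 = z1 + d" using l by (simp_all add: d_def)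
  have "\<alpha> - \<beta> = k + cubF r s (1, y2, z2) - cubF r s (1, y1, z1)"
    unfolding \<alpha>_def \<beta>_def k_def by (simp add: algebra_simps power2_eq_square power3_eq_cube)
  then have a: "\<alpha> - \<beta> = k" using P Q by simp
  \<comment> \<open>Modulo the curve equations, \<open>\<beta>\<close> is \<open>d\<close> times the
    derivative at \<open>z1\<close> of the cubic on the chord, hence a product of differences of its
    roots.\<close>
  have "\<beta> = cubF r s (1, y2, z2) + 2 * cubF r s (1, y1, z1)
      - d ^ 2 * (s * l - l ^ 2 - s * r ^ 2 * (z1 + (z1 + z2)))"
    unfolding \<beta>_def y2 z2 by (simp add: algebra_simps power2_eq_square power3_eq_cube)
  then have "\<beta> = - (d ^ 2 * (s * r ^ 2 * (z3 - z1)))"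
    unfolding P Q z3[symmetric] by (simp add: algebra_simps)
  then have b: "\<beta> * (z1 - z2) = k * (z3 - z1)"
    unfolding k_def z2 by (simp only:) (simp add: algebra_simps power2_eq_square power3_eq_cube)
  have "\<alpha> * y1 - \<beta> * y2 = (\<alpha> - \<beta>) * y1 + l * (\<beta> * (z1 - z2))"
    unfolding y2 z2 by (simp add: algebra_simps)
  then have "\<alpha> * y1 - \<beta> * y2 = k * y3" unfolding a b y3 by (simp add: algebra_simps)
  moreover have "\<alpha> * z1 - \<beta> * z2 = (\<alpha> - \<beta>) * z1 + \<beta> * (z1 - z2)" by (simp add: algebra_simps)
  then have "\<alpha> * z1 - \<beta> * z2 = k * z3" unfolding a b by (simp add: algebra_simps)
  ultimately show ?thesis
    using a unfolding chord_third_def \<alpha>_def[symmetric] \<beta>_def[symmetric] k_def[symmetric] by simp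
qed

text \<open>Here \<open>l\<close> is the implicit derivative of \<open>y\<close> by
  \<open>z\<close>, and Vieta's formula is applied with \<open>z\<close> as a double root.\<close>

lemma tangent_third_affine:
  assumes P: "cubF r s (1, y, z) = 0" and "r \<noteq> 0" "s \<noteq> 0"
    and l: "l * (1 + 2 * y - s * z) = s * y - 3 * s * r ^ 2 * z ^ 2" and b: "1 + 2 * y - s * z \<noteq> 0"
    and z3: "s * r ^ 2 * (2 * z + z3) = s * l - l ^ 2" and y3: "y3 = y + l * (z3 - z)"
  obtains k where "k \<noteq> 0" "tangent_third r s (1, y, z) = scale3 k (1, y3, z3)"
proof -
  define d where "d = 1 + 2 * y - s * z"
  define n where "n = 1 + y ^ 2 + z ^ 2"
  define c where "c = l * d"
  define e where "e = - d * z - c * y"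
  have c: "c = s * y - 3 * s * r ^ 2 * z ^ 2" using l by (simp add: c_def d_def)
  have grad: "gradF r s (1, y, z) = (d * y - z * c, - d, c)"
    using P unfolding c d_def by (simp add: algebra_simps power2_eq_square power3_eq_cube)
  \<comment> \<open>The gradient is the cross product of the tangent direction
    \<open>(0, - c, - d)\<close> with the point. The triple product formula then yields
    \<open>e\<close>, the dot product of these two vectors, and \<open>n\<close>, the squared length
    of the point.\<close>
  have cross: "cross3 (gradF r s (1, y, z)) (1, y, z) = sub3 (scale3 e (1, y, z)) (scale3 n (0, - c, - d))"
    unfolding grad n_def e_def by (simp add: algebra_simps power2_eq_square)
  define \<phi> where "\<phi> = cubF r s (0, - c, - d)"
  define \<gamma> where "\<gamma> = dot3 (gradF r s (0, - c, - d)) (1, y, z)"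
  have phi: "\<phi> = s * r ^ 2 * d ^ 3" by (simp add: \<phi>_def power3_eq_cube)
  have gamma: "\<gamma> = s * c * d - c ^ 2 - 3 * s * r ^ 2 * d ^ 2 * z"
    by (simp add: \<gamma>_def power2_eq_square algebra_simps)
  have "0 < n" unfolding n_def by (intro add_pos_nonneg) auto
  then have n0: "n \<noteq> 0" by simp
  have tan0: "dot3 (gradF r s (1, y, z)) (0, - c, - d) = 0"
    unfolding grad by simp
  have "tangent_third r s (1, y, z) = scale3 (n ^ 3) (- \<phi>, - \<phi> * y - \<gamma> * c, - \<phi> * z - \<gamma> * d)"
    unfolding tangent_third_def cross Let_def cubF_line gradF_line P tan0 \<phi>_def[symmetric] \<gamma>_def[symmetric]
    by (simp add: algebra_simps power2_eq_square power3_eq_cube)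
  also have "(- \<phi>, - \<phi> * y - \<gamma> * c, - \<phi> * z - \<gamma> * d) = scale3 (- \<phi>) (1, y3, z3)"
  proof -
    have "s * r ^ 2 * (z3 - z) = s * l - l ^ 2 - 3 * (s * r ^ 2 * z)"
      unfolding z3[symmetric] by (simp add: algebra_simps)
    then have "d ^ 3 * (s * r ^ 2 * (z3 - z)) = d ^ 3 * (s * l - l ^ 2 - 3 * (s * r ^ 2 * z))"
      by (rule arg_cong)
    then have 1: "\<gamma> * d = \<phi> * (z3 - z)"
      unfolding gamma phi c_def by (simp add: algebra_simps power2_eq_square power3_eq_cube)
    have "\<gamma> * c = l * (\<gamma> * d)" by (simp add: c_def)
    then have 2: "\<gamma> * c = \<phi> * (y3 - y)" unfolding 1 y3 by simp
    show ?thesis using 1 2 by (simp add: algebra_simps)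
  qed
  finally show ?thesis
    using n0 assms(2,3) b by (intro that[of "n ^ 3 * (- \<phi>)"]) (auto simp: phi d_def scale3_scale3)
qed

lemma cubF_third_pt: "cubF r s v = 0 \<Longrightarrow> cubF r s w = 0 \<Longrightarrow> cubF r s (third_pt r s v w) = 0"
  by (simp add: third_pt_def cubF_chord_third cubF_tangent_third)

lemma refl_affine: "y \<noteq> 0 \<Longrightarrow> refl_yx (1, y, z) = scale3 y (1, 1 / y, z / y)"
  by simp

lemma proj_refl_affine: "y \<noteq> 0 \<Longrightarrow> proj (refl_yx (1, y, z)) = proj (1, 1 / y, z / y)"
  by (subst refl_affine) (simp_all del: refl_yx.simps scale3.simps)

section \<open>The operation on projective classes and its inverses\<close>

definition cubic_group :: "rat \<Rightarrow> rat \<Rightarrow> pt set monoid" where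
  "cubic_group r s =
     \<lparr> carrier = {proj v | v. v \<noteq> (0, 0, 0) \<and> cubF r s v = 0},
       monoid.mult = (\<lambda>A B. proj (refl_yx (third_pt r s (SOME v. v \<in> A) (SOME w. w \<in> B)))),
       one = proj (1, -1, 0) \<rparr>"

lemma curve_group_eq:
  "curve_group m n = cubic_group (of_nat (n * (m - n))) (of_nat (m * (m + n)))"
  by (simp add: curve_group_def cubic_group_def Let_def)

text \<open>The representatives picked by \<open>SOME\<close> are nonzero multiples of
  \<open>v\<close> and \<open>w\<close>, and \<open>third_pt\<close> is homogeneous, so any
  representatives give the same class.\<close>

lemma mult_cubic_group: "proj v \<otimes>\<^bsub>cubic_group r s\<^esub> proj w = proj (refl_yx (third_pt r s v w))"
proof -
  obtain a where a: "a \<noteq> 0" "(SOME x. x \<in> proj v) = scale3 a v" using some_proj .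
  obtain b where b: "b \<noteq> 0" "(SOME x. x \<in> proj w) = scale3 b w" using some_proj .
  obtain c where "c \<noteq> 0" "third_pt r s (scale3 a v) (scale3 b w) = scale3 c (third_pt r s v w)"
    using third_pt_scale3[OF a(1) b(1)] .
  then show ?thesis using a b by (simp add: cubic_group_def refl_yx_scale3)
qed

text \<open>No monoid laws are assumed, so the fold is evaluated from its inductive definition and
  keeps the trailing neutral factor.\<close>

lemma finprod_singleton:
  assumes "f x \<otimes>\<^bsub>G\<^esub> \<one>\<^bsub>G\<^esub> \<in> carrier G" "\<one>\<^bsub>G\<^esub> \<in> carrier G"
  shows "finprod G f {x} = f x \<otimes>\<^bsub>G\<^esub> \<one>\<^bsub>G\<^esub>"
proof -
  have e: "y = \<one>\<^bsub>G\<^esub>" if "({}, y) \<in> foldSetD (carrier G) (monoid.mult G \<circ> f) \<one>\<^bsub>G\<^esub>" for y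
    using that by cases auto
  have "y = f x \<otimes>\<^bsub>G\<^esub> \<one>\<^bsub>G\<^esub>" if "({x}, y) \<in> foldSetD (carrier G) (monoid.mult G \<circ> f) \<one>\<^bsub>G\<^esub>" for y
    using that
  proof cases
    case (insertI a A z)
    then have "a = x" "A = {}" by auto
    then show ?thesis using insertI e by auto
  qed auto
  moreover have "({x}, f x \<otimes>\<^bsub>G\<^esub> \<one>\<^bsub>G\<^esub>) \<in> foldSetD (carrier G) (monoid.mult G \<circ> f) \<one>\<^bsub>G\<^esub>"
    using foldSetD.insertI[OF _ _ foldSetD.emptyI[OF assms(2)], of x "monoid.mult G \<circ> f"] assms(1) by simp
  ultimately have "foldD (carrier G) (monoid.mult G \<circ> f) \<one>\<^bsub>G\<^esub> {x} = f x \<otimes>\<^bsub>G\<^esub> \<one>\<^bsub>G\<^esub>"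
    unfolding foldD_def by (intro the_equality)
  then show ?thesis by (simp add: finprod_def)
qed

text \<open>Modulo the curve equation the two coefficients of the chord formula agree, and mirror
  images differ by a multiple of \<open>(1, -1, 0)\<close>. Where the scalar is nonzero, reflection
  is therefore inversion.\<close>

lemma chord_third_refl_yx:
  assumes "cubF r s (x, y, z) = 0"
  shows "chord_third r s (x, y, z) (y, x, z) = scale3 ((x - y) ^ 3 * (s * z - x - y)) (1, -1, 0)"
proof -
  have "dot3 (gradF r s (x, y, z)) (y, x, z) = (x - y) ^ 2 * (s * z - x - y) + 3 * cubF r s (x, y, z)"
    and "dot3 (gradF r s (y, x, z)) (x, y, z) = (x - y) ^ 2 * (s * z - x - y) + 3 * cubF r s (x, y, z)"
    by (simp_all add: algebra_simps power2_eq_square power3_eq_cube)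
  then have g: "dot3 (gradF r s (x, y, z)) (y, x, z) = (x - y) ^ 2 * (s * z - x - y)"
    "dot3 (gradF r s (y, x, z)) (x, y, z) = (x - y) ^ 2 * (s * z - x - y)"
    unfolding assms by simp_all
  show ?thesis
    unfolding chord_third_def g by (simp add: power2_eq_square power3_eq_cube algebra_simps)
qed

text \<open>Uniqueness of inverses: the line through \<open>(1, y, z)\<close> and the identity meets
  the curve in just one further point, the mirror image.\<close>

lemma chord_third_eq_identity:
  assumes v: "cubF r s (1, y, z) = 0" and w: "cubF r s w = 0"
    and "r \<noteq> 0" "s \<noteq> 0" "z \<noteq> 0"
    and k: "k \<noteq> 0" "chord_third r s (1, y, z) w = scale3 k (1, -1, 0)"
  obtains c where "c \<noteq> 0" "w = scale3 c (y, 1, z)"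
proof -
  obtain a b c where w_eq: "w = (a, b, c)" by (cases w)
  define \<alpha> where "\<alpha> = dot3 (gradF r s w) (1, y, z)"
  define \<beta> where "\<beta> = dot3 (gradF r s (1, y, z)) w"
  have e: "\<alpha> - \<beta> * a = k" "\<alpha> * y - \<beta> * b = - k" "\<alpha> * z - \<beta> * c = 0"
    using k(2) unfolding chord_third_def \<alpha>_def[symmetric] \<beta>_def[symmetric] by (auto simp: w_eq)
  have "y * (s * z - 1 - y) = s * r ^ 2 * z ^ 3"
    using v by (simp add: algebra_simps power2_eq_square power3_eq_cube)
  then have W: "s * z - 1 - y \<noteq> 0" using assms(3-5) by auto
  have "\<beta> \<noteq> 0"
  proof
    assume "\<beta> = 0"
    then show False using e k(1) \<open>z \<noteq> 0\<close> by simp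
  qed
  have a: "\<beta> * a = \<alpha> - k" and b: "\<beta> * b = \<alpha> * y + k" and c: "\<beta> * c = \<alpha> * z"
    using e by (simp_all add: algebra_simps)
  \<comment> \<open>Otherwise \<open>w\<close> represents the identity, where the gradient paired
    with \<open>(1, y, z)\<close> is a nonzero multiple of \<open>s * z - 1 - y\<close>.\<close>
  have "\<alpha> \<noteq> 0"
  proof
    assume "\<alpha> = 0"
    then have m: "\<beta> * a = - k" "\<beta> * b = k" "\<beta> * c = 0" using a b c by auto
    have "\<beta> ^ 2 * \<alpha> = (s * (\<beta> * b) * (\<beta> * c) - 2 * (\<beta> * a) * (\<beta> * b) - (\<beta> * b) ^ 2)
        + (s * (\<beta> * a) * (\<beta> * c) - (\<beta> * a) ^ 2 - 2 * (\<beta> * a) * (\<beta> * b)) * y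
        + (s * (\<beta> * a) * (\<beta> * b) - 3 * s * r ^ 2 * (\<beta> * c) ^ 2) * z"
      unfolding \<alpha>_def w_eq by (simp add: power2_eq_square algebra_simps)
    also have "\<dots> = - (k ^ 2 * (s * z - 1 - y))"
      unfolding m by (simp add: power2_eq_square algebra_simps)
    finally show False using \<open>\<alpha> = 0\<close> k(1) W by simp
  qed
  have "cubF r s (\<beta> * a, \<beta> * b, \<beta> * c) = 0"
    using cubF_scale3[of r s \<beta> w] w by (simp add: w_eq)
  \<comment> \<open>The factors \<open>\<alpha>\<close> and \<open>k\<close> belong to the two known
    intersections; the last factor determines \<open>k\<close>.\<close>
  moreover have "cubF r s (\<alpha> - k, \<alpha> * y + k, \<alpha> * z)
      = \<alpha> ^ 3 * cubF r s (1, y, z) - \<alpha> * k * (s * z - 1 - y) * (k - \<alpha> * (1 - y))"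
    by (simp add: algebra_simps power2_eq_square power3_eq_cube)
  ultimately have "\<alpha> * k * (s * z - 1 - y) * (k - \<alpha> * (1 - y)) = 0"
    using v unfolding a b c by simp
  then have k_eq: "k = \<alpha> * (1 - y)" using \<open>\<alpha> \<noteq> 0\<close> k(1) W by simp
  have "w = scale3 (\<alpha> / \<beta>) (y, 1, z)"
    using a b c \<open>\<beta> \<noteq> 0\<close> unfolding k_eq w_eq by (simp add: field_simps)
  then show ?thesis using \<open>\<alpha> \<noteq> 0\<close> \<open>\<beta> \<noteq> 0\<close> by (intro that[of "\<alpha> / \<beta>"]) auto
qed

section \<open>Points reducing to the identity\<close>

locale cubic_nbhd = localization +
  fixes r s :: rat
  assumes r_pint: "r \<in> pint p" and s_div: "s / of_nat p \<in> pint p"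
    and r_nz: "r \<noteq> 0" and s_nz: "s \<noteq> 0"
begin

text \<open>Modulo \<open>p\<close> the cubic degenerates to the three concurrent lines
  \<open>X * Y * (X + Y) = 0\<close>. These are the points reducing to the line
  \<open>X + Y = 0\<close> away from the common point \<open>[0, 0, 1]\<close>.\<close>

definition nbhd :: "(rat \<times> rat) set" where
  "nbhd = {(y, z). y \<in> pint p \<and> z \<in> pint p \<and> (y + 1) / of_nat p \<in> pint p \<and> cubF r s (1, y, z) = 0}"

sublocale lipschitz p nbhd snd
  by unfold_locales (auto simp: nbhd_def)

text \<open>
  The chord through \<open>A\<close> and \<open>B\<close> has slope \<open>s * slope B A\<close> in the \<open>(z, y)\<close>-plane, and
  \<open>z(A) + z(B) + third_z B A = s * corr B A\<close>. Both are written with the common factors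
  \<open>z(A) - z(B)\<close> and \<open>r^2\<close> cancelled, so that the denominators are units at \<open>p\<close> and the tangent case
  \<open>A = B\<close> is included.
\<close>

definition slope :: "rat \<times> rat \<Rightarrow> rat \<times> rat \<Rightarrow> rat" where
  "slope B A = (fst B - r ^ 2 * (snd A ^ 2 + snd A * snd B + snd B ^ 2)) / (fst A + fst B + 1 - s * snd A)"

definition corr :: "rat \<times> rat \<Rightarrow> rat \<times> rat \<Rightarrow> rat" where
  "corr B A = slope B A * (snd A ^ 2 + snd A * snd B + snd B ^ 2 - s * snd A ^ 3 / fst A)
     / (fst A + fst B + 1 - s * snd A)"

definition third_z :: "rat \<times> rat \<Rightarrow> rat \<times> rat \<Rightarrow> rat" where
  "third_z B A = - snd A - snd B + s * corr B A"

definition third_y :: "rat \<times> rat \<Rightarrow> rat \<times> rat \<Rightarrow> rat" where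
  "third_y B A = fst A + s * slope B A * (third_z B A - snd A)"

definition translate :: "rat \<times> rat \<Rightarrow> rat \<times> rat \<Rightarrow> rat \<times> rat" where
  "translate B A = (1 / third_y B A, third_z B A / third_y B A)"

lemma s_pint [intro]: "s \<in> pint p"
  using pint_mult[OF pint_of_nat s_div, of p] by simp

lemma punit_minus_one: assumes "(y + 1) / of_nat p \<in> pint p" shows "punit p y"
proof -
  have "\<not> int p dvd 1" using prime_gt_1_nat[OF prime_p] by simp
  from punit_add_mult[OF punit_uminus[OF punit_of_int[OF this]] assms] show ?thesis by simp
qed

lemma nbhdD:
  assumes "A \<in> nbhd"
  shows "fst A \<in> pint p" "snd A \<in> pint p" "(fst A + 1) / of_nat p \<in> pint p" "punit p (fst A)"
    "fst A \<noteq> 0" "cubF r s (1, fst A, snd A) = 0"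
    "s * (fst A * snd A - r ^ 2 * snd A ^ 3) - fst A - fst A ^ 2 = 0"
  using assms punit_minus_one[of "fst A"] by (auto simp: nbhd_def punit_def)

text \<open>Modulo \<open>p\<close> the expression is (-1) + (-1) + 1 - 0 = -1.\<close>

lemma punit_den:
  assumes "A \<in> nbhd" "B \<in> nbhd" shows "punit p (fst A + fst B + 1 - s * snd A)"
proof (rule punit_minus_one)
  have "(fst A + fst B + 1 - s * snd A + 1) / of_nat p
      = (fst A + 1) / of_nat p + (fst B + 1) / of_nat p - s / of_nat p * snd A"
    by (simp add: field_simps)
  also have "\<dots> \<in> pint p" using nbhdD[OF assms(1)] nbhdD[OF assms(2)] s_div
    by (intro pint_add pint_diff pint_mult)
  finally show "(fst A + fst B + 1 - s * snd A + 1) / of_nat p \<in> pint p" .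
qed

lemma slope_pint: "A \<in> nbhd \<Longrightarrow> B \<in> nbhd \<Longrightarrow> slope B A \<in> pint p"
  unfolding slope_def using r_pint by (intro pint_divide punit_den) (auto dest: nbhdD)

text \<open>Subtracting the two curve equations factors out \<open>snd B - snd A\<close>. The
  cofactor of \<open>fst B - fst A\<close> is a unit, so the slope is integral and divisible by
  \<open>s\<close>.\<close>

lemma slope:
  assumes "A \<in> nbhd" "B \<in> nbhd"
  shows "fst B - fst A = s * slope B A * (snd B - snd A)"
proof -
  have "(fst B - fst A) * (fst A + fst B + 1 - s * snd A)
      = s * (fst B - r ^ 2 * (snd A ^ 2 + snd A * snd B + snd B ^ 2)) * (snd B - snd A)
        + (s * (fst A * snd A - r ^ 2 * snd A ^ 3) - fst A - fst A ^ 2)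
        - (s * (fst B * snd B - r ^ 2 * snd B ^ 3) - fst B - fst B ^ 2)"
    by (simp add: algebra_simps power2_eq_square power3_eq_cube)
  from this[unfolded nbhdD(7)[OF assms(1)] nbhdD(7)[OF assms(2)]]
  have "(fst B - fst A) * (fst A + fst B + 1 - s * snd A)
      = s * (fst B - r ^ 2 * (snd A ^ 2 + snd A * snd B + snd B ^ 2)) * (snd B - snd A)"
    by simp
  then show ?thesis using punitD(2)[OF punit_den[OF assms]] unfolding slope_def by (simp add: field_simps)
qed

lemma snd_inj:
  assumes "A \<in> nbhd" "B \<in> nbhd" "snd A = snd B" shows "A = B"
  using slope[OF assms(1,2)] assms(3) by (simp add: prod_eq_iff)

lemma fst_eq:
  assumes "A \<in> nbhd" shows "fst A = - 1 + s * (snd A - r ^ 2 * snd A ^ 3 / fst A)"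
proof -
  have "fst A * (fst A + 1 - s * snd A) = - s * r ^ 2 * snd A ^ 3"
    using nbhdD(7)[OF assms] by (simp add: algebra_simps power2_eq_square power3_eq_cube)
  then show ?thesis using nbhdD(5)[OF assms] by (simp add: field_simps power2_eq_square power3_eq_cube)
qed

text \<open>Vieta's formula requires a division by \<open>r ^ 2\<close>. The curve equation exhibits
  the factor \<open>r ^ 2\<close> in \<open>1 - slope B A\<close>, and \<open>corr B A\<close> is
  what remains of \<open>slope B A * (1 - slope B A)\<close>.\<close>

lemma third_z:
  assumes "A \<in> nbhd" "B \<in> nbhd"
  shows "s * r ^ 2 * (snd A + snd B + third_z B A) = s * (s * slope B A) - (s * slope B A) ^ 2"
proof -
  define d where "d = fst A + fst B + 1 - s * snd A"
  define h where "h = snd A ^ 2 + snd A * snd B + snd B ^ 2"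
  have d: "d \<noteq> 0" using punitD(2)[OF punit_den[OF assms]] by (simp add: d_def)
  have l: "slope B A * d = fst B - r ^ 2 * h" using d by (simp add: slope_def d_def h_def)
  have "fst A * (fst A + 1 - s * snd A) = - s * r ^ 2 * snd A ^ 3"
    using nbhdD(7)[OF assms(1)] by (simp add: algebra_simps power2_eq_square power3_eq_cube)
  then have e: "fst A + 1 - s * snd A = - (r ^ 2 * (s * snd A ^ 3 / fst A))"
    using nbhdD(5)[OF assms(1)] by (simp add: field_simps)
  have "(1 - slope B A) * d = (fst A + 1 - s * snd A) + r ^ 2 * h"
    unfolding left_diff_distrib l by (simp add: d_def)
  also have "\<dots> = r ^ 2 * (h - s * snd A ^ 3 / fst A)" unfolding e by (simp add: algebra_simps)
  finally have "(1 - slope B A) = r ^ 2 * (h - s * snd A ^ 3 / fst A) / d" using d by (simp add: field_simps)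
  moreover have "corr B A = slope B A * (h - s * snd A ^ 3 / fst A) / d"
    by (simp add: corr_def h_def d_def)
  ultimately have "r ^ 2 * corr B A = slope B A * (1 - slope B A)" by simp
  moreover have "s * r ^ 2 * (snd A + snd B + third_z B A) = s ^ 2 * (r ^ 2 * corr B A)"
    by (simp add: third_z_def power2_eq_square)
  ultimately have "s * r ^ 2 * (snd A + snd B + third_z B A) = s ^ 2 * (slope B A * (1 - slope B A))"
    by (simp only:)
  then show ?thesis by (simp add: algebra_simps power2_eq_square)
qed

lemma third_pt_nbhd:
  assumes "A \<in> nbhd" "B \<in> nbhd"
  obtains k where "k \<noteq> 0"
    "third_pt r s (1, fst A, snd A) (1, fst B, snd B) = scale3 k (1, third_y B A, third_z B A)"
proof (cases "A = B")
  case True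
  have l: "s * slope A A * (1 + 2 * fst A - s * snd A) = s * fst A - 3 * s * r ^ 2 * snd A ^ 2"
    using punitD(2)[OF punit_den[OF assms(1,1)]]
    by (simp add: slope_def power2_eq_square divide_simps) (simp add: algebra_simps)
  have "1 + 2 * fst A - s * snd A \<noteq> 0"
    using punitD(2)[OF punit_den[OF assms(1,1)]] by (simp add: algebra_simps)
  from tangent_third_affine[OF nbhdD(6)[OF assms(1)] r_nz s_nz l this]
  obtain k where "k \<noteq> 0" "tangent_third r s (1, fst A, snd A) = scale3 k (1, third_y A A, third_z A A)"
    using third_z[OF assms(1,1)] by (auto simp: third_y_def)
  then show ?thesis using True that by (simp add: third_pt_def)
next
  case False
  then have z: "snd A \<noteq> snd B" using snd_inj assms by blast
  then have "proj (1, fst A, snd A) \<noteq> proj (1, fst B, snd B)" by (cases A; cases B) (auto simp: proj_eq_iff)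
  then have t: "third_pt r s (1, fst A, snd A) (1, fst B, snd B)
      = scale3 (s * r ^ 2 * (snd B - snd A) ^ 3) (1, third_y B A, third_z B A)"
    using chord_third_affine[OF nbhdD(6)[OF assms(1)] nbhdD(6)[OF assms(2)] slope[OF assms]
        third_z[OF assms]] by (simp add: third_pt_def third_y_def)
  show ?thesis by (rule that[OF _ t]) (use z r_nz s_nz in auto)
qed

section \<open>Lipschitz dependence of the translation on the point\<close>

lemma lip_fst: "lip fst"
  unfolding lip_def
proof (intro conjI ballI)
  fix A B assume AB: "A \<in> nbhd" "B \<in> nbhd"
  show "\<exists>k\<in>pint p. fst A - fst B = (snd A - snd B) * k"
    using slope[OF AB(2,1)] slope_pint[OF AB(2,1)] by (intro bexI[of _ "s * slope A B"]) auto
qed (auto dest: nbhdD)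

lemma lip_consts:
  assumes "B \<in> nbhd"
  shows "lip (\<lambda>_. fst B)" "lip (\<lambda>_. snd B)" "lip (\<lambda>_. r)" "lip (\<lambda>_. s)"
  using nbhdD[OF assms] r_pint by auto

lemma lip_slope: assumes B: "B \<in> nbhd" shows "lip (slope B)"
  unfolding slope_def
  by (intro lip_divide lip_add lip_diff lip_mult lip_power lip_zeta lip_fst lip_consts[OF B] lip_const pint_1 punit_den B)

lemma lip_corr: assumes B: "B \<in> nbhd" shows "lip (corr B)"
  unfolding corr_def
  by (intro lip_divide lip_add lip_diff lip_mult lip_power lip_zeta lip_fst lip_consts[OF B] lip_const
      pint_1 punit_den B lip_slope nbhdD(4))

lemma lip_third_z: assumes B: "B \<in> nbhd" shows "lip (third_z B)"
  unfolding third_z_def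
  by (intro lip_add lip_diff lip_mult lip_uminus lip_zeta lip_consts[OF B] lip_corr B)

text \<open>The quotient of \<open>third_y B A + 1\<close> by \<open>s\<close>, obtained from
  \<open>fst_eq\<close>.\<close>

definition dev :: "rat \<times> rat \<Rightarrow> rat \<times> rat \<Rightarrow> rat" where
  "dev B A = snd A - r ^ 2 * snd A ^ 3 / fst A + slope B A * (third_z B A - snd A)"

lemma lip_dev: assumes B: "B \<in> nbhd" shows "lip (dev B)"
  unfolding dev_def
  by (intro lip_divide lip_add lip_diff lip_mult lip_power lip_zeta lip_fst lip_consts[OF B]
      lip_slope lip_third_z nbhdD(4) B)

lemma third_y_eq: "A \<in> nbhd \<Longrightarrow> third_y B A = - 1 + s * dev B A"
  unfolding third_y_def dev_def by (subst fst_eq) (auto simp: algebra_simps)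

lemma third_y:
  assumes "A \<in> nbhd" "B \<in> nbhd"
  shows "(third_y B A + 1) / of_nat p \<in> pint p" "punit p (third_y B A)"
proof -
  have "(third_y B A + 1) / of_nat p = s / of_nat p * dev B A" using third_y_eq[OF assms(1)] by simp
  also have "\<dots> \<in> pint p" using s_div lip_pint[OF lip_dev] assms by blast
  finally show "(third_y B A + 1) / of_nat p \<in> pint p" .
  then show "punit p (third_y B A)" by (rule punit_minus_one)
qed

lemma nbhd_refl:
  assumes "(y + 1) / of_nat p \<in> pint p" "z \<in> pint p" "cubF r s (1, y, z) = 0"
  shows "(1 / y, z / y) \<in> nbhd"
proof -
  have u: "punit p y" by (rule punit_minus_one) fact
  have "cubF r s (refl_yx (1, y, z)) = 0" using assms(3) by (simp only: cubF_refl_yx)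
  then have "cubF r s (1, 1 / y, z / y) = 0"
    using punitD(2)[OF u] unfolding refl_affine[OF punitD(2)[OF u]] cubF_scale3 by simp
  moreover have "(1 / y + 1) / of_nat p = (y + 1) / of_nat p / y"
    using punitD(2)[OF u] by (simp add: field_simps)
  then have "(1 / y + 1) / of_nat p \<in> pint p" using pint_divide[OF assms(1) u] by simp
  ultimately show ?thesis
    using u assms pint_divide[OF _ u] by (auto simp: nbhd_def simp del: cubF.simps)
qed

lemma translate_mem: assumes "A \<in> nbhd" "B \<in> nbhd" shows "translate B A \<in> nbhd"
  unfolding translate_def
proof (rule nbhd_refl)
  obtain k where k: "k \<noteq> 0"
    "third_pt r s (1, fst A, snd A) (1, fst B, snd B) = scale3 k (1, third_y B A, third_z B A)"
    using third_pt_nbhd[OF assms] .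
  show "cubF r s (1, third_y B A, third_z B A) = 0"
    using cubF_third_pt[OF nbhdD(6)[OF assms(1)] nbhdD(6)[OF assms(2)]] k(1)
    unfolding k(2) cubF_scale3 by simp
qed (use third_y assms lip_pint[OF lip_third_z] in auto)

text \<open>This is the \<open>h\<close> in \<open>z(A + B) = z(A) + z(B) + s h(A)\<close>.\<close>

definition err :: "rat \<times> rat \<Rightarrow> rat \<times> rat \<Rightarrow> rat" where
  "err B A = dev B A * (third_z B A / third_y B A) - corr B A"

lemma lip_third_quot: assumes B: "B \<in> nbhd" shows "lip (\<lambda>A. third_z B A / third_y B A)"
proof (rule lip_divide[OF lip_third_z[OF B]])
  show "lip (third_y B)"
    unfolding third_y_def
    by (intro lip_add lip_diff lip_mult lip_zeta lip_fst lip_consts[OF B] lip_slope lip_third_z B)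
qed (rule third_y(2)[OF _ B])

lemma lip_err: "B \<in> nbhd \<Longrightarrow> lip (err B)"
  unfolding err_def by (intro lip_diff lip_mult lip_dev lip_corr lip_third_quot)

lemma snd_translate:
  assumes "A \<in> nbhd" "B \<in> nbhd"
  shows "snd (translate B A) = snd A + snd B + s * err B A"
proof -
  define q where "q = third_z B A / third_y B A"
  have "third_y B A \<noteq> 0" using third_y(2)[OF assms] punitD(2) by blast
  \<comment> \<open>Dividing by \<open>third_y B A\<close> is a change of sign up to a multiple of
    \<open>third_y B A + 1\<close>, which is divisible by \<open>s\<close>.\<close>
  then have "q = - third_z B A + (third_y B A + 1) * q"
    by (simp add: field_simps q_def)
  also have "\<dots> = - third_z B A + s * dev B A * q"
    unfolding third_y_eq[OF assms(1)] by simp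
  also have "\<dots> = snd A + snd B + s * err B A"
  proof -
    have e: "err B A = dev B A * q - corr B A" by (simp add: err_def q_def)
    show ?thesis unfolding e by (simp add: third_z_def algebra_simps)
  qed
  finally show ?thesis by (simp add: translate_def q_def)
qed

lemma lcong_s_mult: "lip f \<Longrightarrow> lcong (\<lambda>A. s * f A) (\<lambda>_. 0)"
  by (rule lcongI[OF lip_mult[OF lip_const[OF s_div]]]) auto

text \<open>Set \<open>s\<close> to 0 and every \<open>y\<close> to -1 in the formulas. In the
  resulting polynomial the quartic terms in \<open>snd A\<close> cancel, so power sums up to cubes
  suffice.\<close>

lemma lcong_err:
  assumes B: "B \<in> nbhd"
  shows "lcong (err B) (\<lambda>A. (- snd B - 2 * r ^ 2 * snd B ^ 3) * snd A
    + (- 3 * r ^ 2 * snd B ^ 2) * snd A ^ 2 + (- 2 * r ^ 2 * snd B) * snd A ^ 3)"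
proof -
  let ?h = "\<lambda>A. snd A ^ 2 + snd A * snd B + snd B ^ 2"
  let ?l = "\<lambda>A. 1 + r ^ 2 * ?h A"
  note lips = lip_add lip_diff lip_mult lip_uminus lip_power lip_zeta lip_fst lip_consts[OF B] lip_const pint_1
  have lh: "lip ?h" and ll: "lip ?l" by (intro lips)+
  have fst: "lcong fst (\<lambda>_. - 1)"
  proof (rule lcongI[of "\<lambda>A. s / of_nat p * (snd A - r ^ 2 * snd A ^ 3 / fst A)"])
    show "lip (\<lambda>A. s / of_nat p * (snd A - r ^ 2 * snd A ^ 3 / fst A))"
      by (intro lips lip_divide nbhdD(4) s_div)
  qed (subst fst_eq, auto)
  have fB: "lcong (\<lambda>_. fst B) (\<lambda>_. - 1)"
    by (rule lcongI[of "\<lambda>_. (fst B + 1) / of_nat p"]) (use nbhdD(3)[OF B] in auto)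
  have den: "lcong (\<lambda>A. fst A + fst B + 1 - s * snd A) (\<lambda>_. - 1)"
    by (rule lcong_eq[OF lcong_diff[OF lcong_add[OF lcong_add[OF fst fB] lcong_refl] lcong_s_mult]]) auto
  have lden: "lip (\<lambda>A. fst A + fst B + 1 - s * snd A)" by (intro lips)
  have sl: "lcong (slope B) ?l"
    unfolding slope_def
    by (rule lcong_eq[OF lcong_divide_minus_one[OF lcong_diff[OF fB lcong_refl] _ lden _ den]])
      (intro lips punit_den B | simp)+
  have corr: "lcong (corr B) (\<lambda>A. - (?l A * ?h A))"
  proof -
    have "lcong (\<lambda>A. s * snd A ^ 3 / fst A) (\<lambda>_. 0)"
      using lcong_s_mult[of "\<lambda>A. snd A ^ 3 / fst A"] lip_divide[OF lip_power[OF lip_zeta] lip_fst nbhdD(4)]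
      by simp
    from lcong_diff[OF lcong_refl[of ?h] this] have "lcong (\<lambda>A. ?h A - s * snd A ^ 3 / fst A) ?h" by simp
    from lcong_mult[OF sl this lip_slope[OF B] lh] show ?thesis
      unfolding corr_def
      by (rule lcong_divide_minus_one[OF _ lip_mult[OF ll lh] lden punit_den[OF _ B] den])
  qed
  have tz: "lcong (third_z B) (\<lambda>A. - snd A - snd B)"
    unfolding third_z_def
    by (rule lcong_eq[OF lcong_add[OF lcong_refl lcong_s_mult[OF lip_corr[OF B]]]]) simp
  have ltz: "lip (\<lambda>A. - snd A - snd B)" by (intro lips)
  have ty: "lcong (third_y B) (\<lambda>_. - 1)"
    by (rule lcongI[OF lip_mult[OF lip_const[OF s_div] lip_dev[OF B]]]) (simp add: third_y_eq)
  have q: "lcong (\<lambda>A. third_z B A / third_y B A) (\<lambda>A. - (- snd A - snd B))"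
    using lcong_divide_minus_one[OF tz ltz lcong_lip[OF ty] third_y(2)[OF _ B] ty] by auto
  have 1: "lcong (\<lambda>A. r ^ 2 * snd A ^ 3 / fst A) (\<lambda>A. - (r ^ 2 * snd A ^ 3))"
    by (rule lcong_divide_minus_one[OF lcong_refl _ lip_fst nbhdD(4) fst]) (intro lips)
  have 2: "lcong (\<lambda>A. third_z B A - snd A) (\<lambda>A. - snd A - snd B - snd A)"
    by (rule lcong_diff[OF tz lcong_refl])
  have dev: "lcong (dev B) (\<lambda>A. snd A - - (r ^ 2 * snd A ^ 3) + ?l A * (- snd A - snd B - snd A))"
    unfolding dev_def
    by (rule lcong_add[OF lcong_diff[OF lcong_refl 1] lcong_mult[OF sl 2 lip_slope[OF B]]]) (intro lips)
  have "lcong (err B) (\<lambda>A. (snd A - - (r ^ 2 * snd A ^ 3) + ?l A * (- snd A - snd B - snd A))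
      * (- (- snd A - snd B)) - - (?l A * ?h A))"
    unfolding err_def
    by (rule lcong_diff[OF lcong_mult[OF dev q lip_dev[OF B]] corr]) (intro lips)
  then show ?thesis by (rule lcong_eq) (simp add: algebra_simps power2_eq_square power3_eq_cube)
qed

theorem translate_no_periodic_point:
  assumes "A \<in> nbhd" "B \<in> nbhd" "punit p (snd B)" "s / of_nat p ^ 2 \<in> pint p \<or> 5 \<le> p" "0 < n"
  shows "(translate B ^^ n) A \<noteq> A"
proof -
  have g: "translate B \<in> nbhd \<rightarrow> nbhd" using translate_mem assms(2) by blast
  show ?thesis
    using assms(4)
  proof
    assume s2: "s / of_nat p ^ 2 \<in> pint p"
    have "drift (translate B) 1"
    proof (rule driftI[OF g assms(3), where k = "of_nat p"])
      show "lip (\<lambda>A. s / of_nat p ^ 2 * err B A)"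
        by (rule lip_mult[OF lip_const[OF s2] lip_err[OF assms(2)]])
    qed (use snd_translate[OF _ assms(2)] in auto)
    then show ?thesis using drift_no_periodic_point assms by blast
  next
    assume p5: "5 \<le> p"
    have bp: "snd B \<in> pint p" using nbhdD assms(2) by blast
    have "drift (translate B ^^ p) (of_nat p)"
    proof (rule drift_funpow_of_cubic[OF g assms(3) s_div p5 _ _ _ lcong_err[OF assms(2)]])
      show "snd (translate B x) = snd x + snd B + of_nat p * (s / of_nat p) * err B x" if "x \<in> nbhd" for x
        using snd_translate[OF that assms(2)] by simp
    qed (use bp r_pint in auto)
    then have "((translate B ^^ p) ^^ n) A \<noteq> A" using drift_no_periodic_point assms by blast
    \<comment> \<open>A fixed point of the \<open>n\<close>-th iterate would also be fixed by its
      \<open>p\<close>-th power, which is the \<open>n\<close>-th power of the drift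
      \<open>translate B ^^ p\<close>.\<close>
    then have *: "((translate B ^^ n) ^^ p) A \<noteq> A" by (simp add: funpow_mult mult.commute)
    show ?thesis
    proof
      assume "(translate B ^^ n) A = A"
      then have "((translate B ^^ n) ^^ k) A = A" for k by (induction k) auto
      with * show False by blast
    qed
  qed
qed

end

section \<open>Powers, inverses and independence of a single point\<close>

locale cubic_nbhd_rigid = cubic_nbhd +
  assumes rigid: "s / of_nat p ^ 2 \<in> pint p \<or> 5 \<le> p"
begin

abbreviation G where "G \<equiv> cubic_group r s"

definition pt_of :: "rat \<times> rat \<Rightarrow> pt set" where
  "pt_of A = proj (1, fst A, snd A)"

definition neg :: "rat \<times> rat \<Rightarrow> rat \<times> rat" where
  "neg A = (1 / fst A, snd A / fst A)"

text \<open>For \<open>p = 2\<close> the assumption \<open>rigid\<close> makes \<open>s * c\<close>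
  divisible by 4; for odd \<open>p\<close>, 2 is a unit and \<open>s * c\<close> is not. This
  excludes nontrivial points of order 2 in \<open>nbhd\<close>.\<close>

lemma two_neq_s_mult: assumes "c \<in> pint p" shows "2 \<noteq> s * c"
proof (cases "p = 2")
  case True
  then have "s / of_nat p ^ 2 \<in> pint p" using rigid by simp
  from pint_mult[OF this assms] have m: "s / of_nat p ^ 2 * c \<in> pint p" .
  have "punit p 1" using punit_of_nat[of 1] True by simp
  from punit_neq_mult[OF this m] show ?thesis by (simp add: True power2_eq_square mult.commute)
next
  case False
  then have "\<not> p dvd 2" using prime_p two_is_prime_nat primes_dvd_imp_eq by blast
  from punit_neq_mult[OF punit_of_nat[OF this] pint_mult[OF s_div assms]] show ?thesis by simp
qed

lemma pt_of_inj: "pt_of A = pt_of B \<Longrightarrow> A = B"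
  by (cases A; cases B) (auto simp: pt_of_def proj_eq_iff)

lemma pt_of_carrier: assumes "A \<in> nbhd" shows "pt_of A \<in> carrier G"
proof -
  have "(1, fst A, snd A) \<noteq> ((0, 0, 0) :: pt)" by simp
  then show ?thesis using nbhdD(6)[OF assms]
    unfolding pt_of_def cubic_group_def partial_object.simps mem_Collect_eq by blast
qed

lemma zero_nbhd: "(-1, 0) \<in> nbhd"
  using pint_of_int[of "-1"] by (simp add: nbhd_def)

lemma one_eq: "\<one>\<^bsub>G\<^esub> = pt_of (-1, 0)"
  by (simp add: pt_of_def cubic_group_def)

lemma pt_of_neg: "A \<in> nbhd \<Longrightarrow> pt_of (neg A) = proj (refl_yx (1, fst A, snd A))"
  by (subst proj_refl_affine) (auto dest: nbhdD simp: pt_of_def neg_def)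

lemma neg_nbhd: "A \<in> nbhd \<Longrightarrow> neg A \<in> nbhd"
  unfolding neg_def using nbhdD by (intro nbhd_refl) auto

lemma mult_pt_of:
  assumes "A \<in> nbhd" "B \<in> nbhd"
  shows "pt_of A \<otimes>\<^bsub>G\<^esub> pt_of B = pt_of (translate B A)"
proof -
  obtain k where k: "k \<noteq> 0"
    "third_pt r s (1, fst A, snd A) (1, fst B, snd B) = scale3 k (1, third_y B A, third_z B A)"
    using third_pt_nbhd[OF assms] .
  have "third_y B A \<noteq> 0" using third_y(2)[OF assms] punitD(2) by blast
  from proj_refl_affine[OF this] show ?thesis
    unfolding pt_of_def mult_cubic_group k(2) refl_yx_scale3 proj_scale3[OF k(1)]
    by (simp add: translate_def)
qed

lemma funpow_translate_mem: assumes "B \<in> nbhd" shows "(translate B ^^ k) (-1, 0) \<in> nbhd"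
  by (induction k) (simp_all add: zero_nbhd translate_mem[OF _ assms])

lemma pow_pt_of:
  assumes "B \<in> nbhd" shows "pt_of B [^]\<^bsub>G\<^esub> (k::nat) = pt_of ((translate B ^^ k) (-1, 0))"
proof (induction k)
  case 0
  then show ?case by (simp add: nat_pow_def one_eq)
next
  case (Suc k)
  then show ?case using mult_pt_of[OF funpow_translate_mem assms] assms by (simp add: nat_pow_def)
qed

text \<open>\<open>Y\<close> ranges over the whole carrier because the description defining
  \<open>inv\<close> does. The tangent case is contradictory, and the chord case is
  \<open>chord_third_eq_identity\<close>.\<close>

lemma eq_neg_of_mult_eq_one:
  assumes A: "A \<in> nbhd" "snd A \<noteq> 0" and Y: "Y \<in> carrier G" and AY: "pt_of A \<otimes>\<^bsub>G\<^esub> Y = \<one>\<^bsub>G\<^esub>"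
  shows "Y = pt_of (neg A)"
proof -
  obtain w where w: "Y = proj w" "cubF r s w = 0" using Y by (auto simp: cubic_group_def)
  let ?v = "(1, fst A, snd A)"
  show ?thesis
  proof (cases "proj ?v = proj w")
    case True
    then have "pt_of (translate A A) = pt_of (-1, 0)"
      using AY A mult_pt_of[OF A(1) A(1)] by (simp add: w one_eq pt_of_def)
    then have "translate A A = (-1, 0)" by (rule pt_of_inj)
    then have "third_z A A = 0" using third_y(2)[OF A(1) A(1)] by (simp add: translate_def punit_def)
    \<comment> \<open>\<open>corr A A\<close> contains the factor \<open>snd A ^ 2\<close>, so
      \<open>third_z A A = 0\<close> reduces to \<open>2 = s * (snd A * c)\<close>.\<close>
    moreover define c where "c = slope A A * (3 - s * snd A / fst A) / (fst A + fst A + 1 - s * snd A)"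
    have "snd A ^ 2 + snd A * snd A + snd A ^ 2 - s * snd A ^ 3 / fst A = snd A * snd A * (3 - s * snd A / fst A)"
      by (simp add: power2_eq_square power3_eq_cube algebra_simps)
    then have "corr A A = snd A * (snd A * c)" by (simp add: corr_def c_def)
    ultimately have "snd A * (s * (snd A * c) - 2) = 0" by (simp add: third_z_def algebra_simps)
    then have "2 = s * (snd A * c)" using A(2) by simp
    moreover have "c \<in> pint p" unfolding c_def
      using nbhdD[OF A(1)] A(1)
      by (intro pint_divide pint_mult pint_diff slope_pint punit_den s_pint pint_numeral)
    ultimately show ?thesis using two_neq_s_mult nbhdD(2)[OF A(1)] by blast
  next
    case False
    have "proj (refl_yx (chord_third r s ?v w)) = proj (1, -1, 0)"
      using AY False by (simp add: w(1) pt_of_def one_eq mult_cubic_group third_pt_def)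
    then obtain k where k: "k \<noteq> 0" "refl_yx (chord_third r s ?v w) = scale3 k (1, -1, 0)"
      by (auto simp: proj_eq_iff)
    have "chord_third r s ?v w = refl_yx (scale3 k (1, -1, 0))" using k(2) by (metis refl_yx_refl_yx)
    then have "chord_third r s ?v w = scale3 (- k) (1, -1, 0)" by simp
    moreover have "- k \<noteq> 0" using k by simp
    ultimately obtain c where c: "c \<noteq> 0" "w = scale3 c (fst A, 1, snd A)"
      using chord_third_eq_identity[OF nbhdD(6)[OF A(1)] w(2) r_nz s_nz A(2)] by blast
    have "Y = proj (fst A, 1, snd A)" unfolding w(1) c(2) by (rule proj_scale3[OF c(1)])
    also have "\<dots> = pt_of (neg A)" unfolding pt_of_neg[OF A(1)] by (simp only: refl_yx.simps)
    finally show ?thesis .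
  qed
qed

text \<open>The mirror image is a two-sided inverse by \<open>chord_third_refl_yx\<close>, applied
  in both orders, and the only one by \<open>eq_neg_of_mult_eq_one\<close>.\<close>

lemma inv_pt_of:
  assumes A: "A \<in> nbhd" "snd A \<noteq> 0"
  shows "inv\<^bsub>G\<^esub> (pt_of A) = pt_of (neg A)"
proof -
  let ?y = "fst A" and ?z = "snd A"
  note nA = nbhdD[OF A(1)]
  \<comment> \<open>For \<open>y = 1\<close> the point would be its own mirror image and there would
    be no chord.\<close>
  have "?y \<noteq> 1"
  proof
    assume "?y = 1"
    then have "2 = s * (?z * (1 - r ^ 2 * ?z ^ 2))" using nA(7) by (simp add: algebra_simps power2_eq_square power3_eq_cube)
    moreover have "?z * (1 - r ^ 2 * ?z ^ 2) \<in> pint p" using nA(2) r_pint by auto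
    ultimately show False using two_neq_s_mult by blast
  qed
  have "?y * (s * ?z - 1 - ?y) = s * r ^ 2 * ?z ^ 3"
    using nA(7) by (simp add: algebra_simps power2_eq_square power3_eq_cube)
  then have W: "s * ?z - 1 - ?y \<noteq> 0" using r_nz s_nz A(2) by auto
  have ne: "proj (1, ?y, ?z) \<noteq> proj (?y, 1, ?z)"
  proof
    assume "proj (1, ?y, ?z) = proj (?y, 1, ?z)"
    then obtain c where "(1, ?y, ?z) = scale3 c (?y, 1, ?z)" unfolding proj_eq_iff by blast
    then have "?y = c" "?z = c * ?z" by (simp_all only: scale3.simps prod.inject mult_1_right)
    then show False using \<open>?y \<noteq> 1\<close> A(2) by simp
  qed
  have F: "cubF r s (?y, 1, ?z) = 0" using cubF_refl_yx[of r s "(1, ?y, ?z)", unfolded refl_yx.simps] nA(6) by (rule trans)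
  have n: "pt_of (neg A) = proj (?y, 1, ?z)" unfolding pt_of_neg[OF A(1)] by (simp only: refl_yx.simps)
  have O: "proj (refl_yx (scale3 c (1, -1, 0))) = \<one>\<^bsub>G\<^esub>" if "c \<noteq> 0" for c
    using that proj_scale3[of "- c" "(1, -1, 0)"] by (simp add: one_eq pt_of_def)
  have "s * ?z - ?y - 1 \<noteq> 0" using W by linarith
  have "pt_of A \<otimes>\<^bsub>G\<^esub> pt_of (neg A) = \<one>\<^bsub>G\<^esub>"
    unfolding n pt_of_def[of A] mult_cubic_group third_pt_def if_not_P[OF ne] chord_third_refl_yx[OF nA(6)]
    by (rule O) (use \<open>?y \<noteq> 1\<close> W in simp)
  moreover have "pt_of (neg A) \<otimes>\<^bsub>G\<^esub> pt_of A = \<one>\<^bsub>G\<^esub>"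
    unfolding n pt_of_def[of A] mult_cubic_group third_pt_def if_not_P[OF ne[symmetric]] chord_third_refl_yx[OF F]
    by (rule O) (use \<open>?y \<noteq> 1\<close> \<open>s * ?z - ?y - 1 \<noteq> 0\<close> in simp)
  ultimately show ?thesis
    unfolding m_inv_def using pt_of_carrier[OF neg_nbhd[OF A(1)]]
    by (intro the_equality conjI) (assumption | elim conjE, rule eq_neg_of_mult_eq_one[OF A])+
qed

theorem one_le_Z_rank:
  assumes B: "B \<in> nbhd" "punit p (snd B)" shows "1 \<le> Z_rank G"
proof -
  have "Z_independent G {pt_of B}"
    unfolding Z_independent_def
  proof (intro conjI allI impI ballI)
    fix c :: "pt set \<Rightarrow> int" and x
    assume fin: "finprod G (\<lambda>x. x [^]\<^bsub>G\<^esub> c x) {pt_of B} = \<one>\<^bsub>G\<^esub>" and "x \<in> {pt_of B}"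
    then have x: "x = pt_of B" by simp
    show "c x = 0"
    proof (rule ccontr)
      assume c: "c x \<noteq> 0"
      define k where "k = nat \<bar>c x\<bar>"
      define A where "A = (translate B ^^ k) (-1, 0)"
      have A: "A \<in> nbhd" unfolding A_def by (rule funpow_translate_mem[OF B(1)])
      have "0 < k" using c by (simp add: k_def)
      then have "A \<noteq> (-1, 0)"
        unfolding A_def by (intro translate_no_periodic_point zero_nbhd B rigid)
      then have sA: "snd A \<noteq> 0" using snd_inj[OF A zero_nbhd] by auto
      have pw: "x [^]\<^bsub>G\<^esub> k = pt_of A" unfolding A_def x by (rule pow_pt_of[OF B(1)])
      \<comment> \<open>For negative exponents the power is the inverse of a positive power, which
        stays in \<open>nbhd\<close> with nonzero \<open>z\<close>.\<close>
      obtain A' where A': "A' \<in> nbhd" "snd A' \<noteq> 0" "x [^]\<^bsub>G\<^esub> c x = pt_of A'"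
      proof (cases "c x < 0")
        case True
        then have "nat (- c x) = k" by (simp add: k_def)
        with True have "x [^]\<^bsub>G\<^esub> c x = inv\<^bsub>G\<^esub> (x [^]\<^bsub>G\<^esub> k)"
          by (simp only: int_pow_def2 if_True)
        also have "\<dots> = pt_of (neg A)" unfolding pw by (rule inv_pt_of[OF A sA])
        finally have "x [^]\<^bsub>G\<^esub> c x = pt_of (neg A)" .
        moreover have "snd (neg A) \<noteq> 0" using sA nbhdD(5)[OF A] by (simp add: neg_def)
        ultimately show ?thesis using that neg_nbhd[OF A] by blast
      next
        case False
        then have "nat (c x) = k" by (simp add: k_def)
        with False have "x [^]\<^bsub>G\<^esub> c x = x [^]\<^bsub>G\<^esub> k" by (simp only: int_pow_def2 if_False)
        then show ?thesis using that[OF A sA] pw by simp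
      qed
      have cl: "x [^]\<^bsub>G\<^esub> c x \<otimes>\<^bsub>G\<^esub> \<one>\<^bsub>G\<^esub> \<in> carrier G"
        unfolding A'(3) one_eq mult_pt_of[OF A'(1) zero_nbhd]
        by (intro pt_of_carrier translate_mem zero_nbhd A')
      have o: "\<one>\<^bsub>G\<^esub> \<in> carrier G" unfolding one_eq by (intro pt_of_carrier zero_nbhd)
      have "x [^]\<^bsub>G\<^esub> c x \<otimes>\<^bsub>G\<^esub> \<one>\<^bsub>G\<^esub> = \<one>\<^bsub>G\<^esub>"
        using finprod_singleton[where f = "\<lambda>x. x [^]\<^bsub>G\<^esub> c x", OF cl o] fin
        unfolding x by (rule trans[OF sym])
      then have "pt_of A' \<otimes>\<^bsub>G\<^esub> \<one>\<^bsub>G\<^esub> = \<one>\<^bsub>G\<^esub>" unfolding A'(3) .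
      \<comment> \<open>Neutrality of the identity is bypassed: the equation makes the identity the
        inverse of \<open>A'\<close>, which forces \<open>snd A' = 0\<close>.\<close>
      from eq_neg_of_mult_eq_one[OF A'(1,2) o this] have "(-1, 0) = neg A'"
        unfolding one_eq by (rule pt_of_inj)
      then show False using A'(2) nbhdD(5)[OF A'(1)] by (simp add: neg_def)
    qed
  qed (simp_all add: pt_of_carrier B)
  then have "enat (card {pt_of B}) \<in> {enat (card S) | S. Z_independent G S}" by blast
  from Sup_upper[OF this] show ?thesis by (simp add: Z_rank_def one_enat_def)
qed

end

section \<open>Choice of the point\<close>

lemma one_le_Z_rank_curve_group:
  assumes p: "prime p" and mn: "0 < n" "n < m" and dvd: "p dvd m * (m + n)"
    and rigid: "p ^ 2 dvd m * (m + n) \<or> 5 \<le> p"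
    and yz: "y \<in> pint p" "punit p z" "(y + 1) / of_nat p \<in> pint p"
    and F: "cubF (of_nat (n * (m - n))) (of_nat (m * (m + n))) (1, y, z) = 0"
  shows "1 \<le> Z_rank (curve_group m n)"
proof -
  interpret localization p by unfold_locales (rule p)
  let ?r = "of_nat (n * (m - n)) :: rat" and ?s = "of_nat (m * (m + n)) :: rat"
  have quot: "of_nat a / of_nat b \<in> pint p" if "b dvd a" for a b
  proof -
    have "of_nat a / of_nat b = (of_nat (a div b) :: rat)" using that by auto
    then show ?thesis by (simp only: pint_of_nat)
  qed
  interpret cubic_nbhd_rigid p ?r ?s
  proof unfold_locales
    show "?s / of_nat p ^ 2 \<in> pint p \<or> 5 \<le> p"
      using rigid quot[of "p ^ 2"] by (metis of_nat_power)
  qed (use quot[OF dvd] mn in \<open>auto simp del: of_nat_mult\<close>)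
  have "(y, z) \<in> nbhd" using yz F punitD(1) by (simp only: nbhd_def mem_Collect_eq case_prod_conv)
  from one_le_Z_rank[OF this] yz show ?thesis unfolding curve_group_eq by simp
qed

text \<open>With \<open>a = n\<close> and \<open>b = m - n\<close>, the affine coordinates are
  tangent lengths of the right triangle, that is \<open>s\<close> minus a side. Two tangent lengths
  of one triangle satisfy the curve equation.\<close>

lemma cubF_triangle:
  assumes "a \<noteq> 0" "b \<noteq> 0"
  shows "cubF (a * b) ((a + b) * (2 * a + b)) (1, (2 * a + b) / b, 1 / (a * b)) = 0"
    and "cubF (a * b) ((a + b) * (2 * a + b)) (1, (a + b) / a, 1 / (a * b)) = 0"
proof -
  let ?F = "cubF (a * b) ((a + b) * (2 * a + b))"
  have 1: "(1, (2 * a + b) / b, 1 / (a * b)) = scale3 (1 / (a * b)) (a * b, a * (2 * a + b), 1)"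
    and 2: "(1, (a + b) / a, 1 / (a * b)) = scale3 (1 / (a * b)) (a * b, b * (a + b), 1)"
    using assms by simp_all
  have "?F (a * b, a * (2 * a + b), 1) = 0" "?F (a * b, b * (a + b), 1) = 0"
    by (simp_all add: algebra_simps power2_eq_square power3_eq_cube)
  then show "?F (1, (2 * a + b) / b, 1 / (a * b)) = 0" "?F (1, (a + b) / a, 1 / (a * b)) = 0"
    unfolding 1 2 cubF_scale3 by (simp_all only: mult_zero_right)
qed

lemma one_le_Z_rank_of_dvd_left:
  assumes p: "prime p" and mn: "0 < n" "n < m" "coprime m n" and dvd: "p dvd m"
    and rigid: "p ^ 2 dvd m \<or> 5 \<le> p"
  shows "1 \<le> Z_rank (curve_group m n)"
proof -
  interpret localization p by unfold_locales (rule p)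
  obtain d where d: "m = n + d" "0 < d" using mn by (metis less_imp_add_positive)
  obtain k where k: "m = p * k" using dvd by blast
  have pn: "\<not> p dvd n" using p dvd mn(3) by (metis coprime_common_divisor not_prime_unit)
  then have pd: "\<not> p dvd d" using dvd d by (metis dvd_add_left_iff)
  note u = punit_of_nat[OF pn] punit_of_nat[OF pd]
  let ?y = "of_nat (m + n) / of_nat d :: rat" and ?z = "1 / (of_nat n * of_nat d) :: rat"
  show ?thesis
  proof (rule one_le_Z_rank_curve_group[OF p mn(1,2)])
    show "?y \<in> pint p" using u by (intro pint_divide pint_of_nat)
    have "punit p 1" using punit_mult[OF punit_inverse[OF u(1)] u(1)] u by (simp add: punit_def)
    then show "punit p ?z" using u by (intro punit_divide punit_mult)
    \<comment> \<open>Since \<open>d = m - n\<close>, the numerator \<open>m + n + d\<close> is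
      \<open>2 * m\<close>.\<close>
    have e: "(?y + 1) / of_nat p = of_nat (2 * k) / of_nat d"
    proof -
      have "?y + 1 = of_nat (m + n + d) / of_nat d" using d by (simp add: field_simps)
      also have "m + n + d = p * (2 * k)" using d k by simp
      finally show ?thesis by simp
    qed
    show "(?y + 1) / of_nat p \<in> pint p" unfolding e by (intro pint_divide pint_of_nat u)
    show "cubF (of_nat (n * (m - n))) (of_nat (m * (m + n))) (1, ?y, ?z) = 0"
      using cubF_triangle(1)[of "of_nat n" "of_nat d"] d mn(1)
      by (simp add: algebra_simps del: cubF.simps)
  qed (use dvd rigid in auto)
qed

lemma one_le_Z_rank_of_dvd_right:
  assumes p: "prime p" and mn: "0 < n" "n < m" "coprime m n" and dvd: "p dvd m + n" and p5: "5 \<le> p"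
  shows "1 \<le> Z_rank (curve_group m n)"
proof -
  interpret localization p by unfold_locales (rule p)
  obtain d where d: "m = n + d" "0 < d" using mn by (metis less_imp_add_positive)
  obtain k where k: "m + n = p * k" using dvd by blast
  have "coprime (m + n) n" using mn(3) by (simp add: coprime_iff_gcd_eq_1)
  then have pn: "\<not> p dvd n" using p dvd by (metis coprime_common_divisor not_prime_unit)
  \<comment> \<open>Oddness of \<open>p\<close> is needed to keep it from dividing \<open>d\<close>,
    because \<open>m + n = 2 * n + d\<close>.\<close>
  have "\<not> p dvd 2" using p5 by (auto dest: dvd_imp_le)
  then have "\<not> p dvd 2 * n" using pn p by (simp add: prime_dvd_mult_iff)
  moreover have "m + n = 2 * n + d" using d by simp
  ultimately have pd: "\<not> p dvd d" using dvd by (metis dvd_add_left_iff)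
  note u = punit_of_nat[OF pn] punit_of_nat[OF pd]
  let ?y = "of_nat m / of_nat n :: rat" and ?z = "1 / (of_nat n * of_nat d) :: rat"
  show ?thesis
  proof (rule one_le_Z_rank_curve_group[OF p mn(1,2)])
    show "?y \<in> pint p" using u by (intro pint_divide pint_of_nat)
    have "punit p 1" using punit_mult[OF punit_inverse[OF u(1)] u(1)] u by (simp add: punit_def)
    then show "punit p ?z" using u by (intro punit_divide punit_mult)
    have e: "(?y + 1) / of_nat p = of_nat k / of_nat n"
    proof -
      have "?y + 1 = of_nat (m + n) / of_nat n" using mn by (simp add: field_simps)
      then show ?thesis unfolding k by simp
    qed
    show "(?y + 1) / of_nat p \<in> pint p" unfolding e by (intro pint_divide pint_of_nat u)
    show "cubF (of_nat (n * (m - n))) (of_nat (m * (m + n))) (1, ?y, ?z) = 0"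
      using cubF_triangle(2)[of "of_nat n" "of_nat d"] d mn(1)
      by (simp add: algebra_simps del: cubF.simps)
  qed (use dvd p5 in auto)
qed

text \<open>Here \<open>r = 2\<close> and \<open>s = 12\<close>, so 4 divides \<open>s\<close>. The
  triangle points have \<open>z = 1 / 2\<close>, not integral at 2; the point
  \<open>[-3, -1, 1]\<close> has \<open>z = - 1 / 3\<close>, a unit, and
  \<open>y + 1 = 4 / 3\<close>.\<close>

lemma one_le_Z_rank_3_1: "1 \<le> Z_rank (curve_group 3 1)"
proof -
  interpret localization 2 by unfold_locales (rule two_is_prime_nat)
  have u: "punit 2 3" using punit_of_nat[of 3] by simp
  have "punit 2 1" using punit_of_nat[of 1] by simp
  show ?thesis
  proof (rule one_le_Z_rank_curve_group[where p = 2 and y = "1 / 3" and z = "- 1 / 3"])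
    show "1 / 3 \<in> pint 2" using u by (intro pint_divide) auto
    show "punit 2 (- 1 / 3)" using u \<open>punit 2 1\<close> by (intro punit_divide punit_uminus)
    show "(1 / 3 + 1) / rat_of_nat 2 \<in> pint 2" using pint_divide[OF pint_of_nat u, of 2] by simp
  qed (simp_all add: power2_eq_square power3_eq_cube)
qed

lemma le_6_of_prime_factors:
  fixes m :: nat
  assumes "0 < m" and "\<And>p. prime p \<Longrightarrow> p dvd m \<Longrightarrow> p < 5 \<and> \<not> p ^ 2 dvd m"
  shows "m \<in> {1, 2, 3, 6}"
proof -
  have "m dvd 6"
  proof (rule multiplicity_le_imp_dvd)
    fix p :: nat assume p: "prime p"
    show "multiplicity p m \<le> multiplicity p 6"
    proof (cases "p dvd m")
      case True
      then have "p < 5" and sq: "\<not> p ^ 2 dvd m" using assms(2) p by auto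
      then have "p = 2 \<or> p = 3" using p prime_ge_2_nat[OF p] by (cases "p = 4") auto
      then have "p ^ 1 dvd 6" by auto
      then have "1 \<le> multiplicity p 6" using p by (intro multiplicity_geI) auto
      moreover have "multiplicity p m < 2"
        using sq p assms(1) by (intro multiplicity_lessI) auto
      ultimately show ?thesis by simp
    qed (simp add: not_dvd_imp_multiplicity_0)
  qed (use assms in auto)
  then have "m \<le> 6" by (rule dvd_imp_le) simp
  then have "m = 1 \<or> m = 2 \<or> m = 3 \<or> m = 4 \<or> m = 5 \<or> m = 6" using assms(1) by linarith
  then show ?thesis using \<open>m dvd 6\<close> by auto
qed

theorem theorem4:
  fixes m n :: nat
  assumes "0 < n" and "n < m" and "coprime m n"
    and "\<not> (odd m \<and> (\<exists>k::nat. m = k ^ 3))"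
    and "\<not> (\<exists>k::nat. m = 2 * k ^ 3)"
  shows "Z_rank (curve_group m n) \<ge> 1"
proof (cases "\<exists>p. prime p \<and> p dvd m \<and> (p ^ 2 dvd m \<or> 5 \<le> p)")
  case True
  then show ?thesis using one_le_Z_rank_of_dvd_left assms by blast
next
  case False
  \<comment> \<open>What remains is squarefree with prime factors 2 and 3 only; coprimality then
    leaves four pairs with \<open>m\<close> equal to 3 or 6.\<close>
  have "m \<in> {1, 2, 3, 6}"
    by (rule le_6_of_prime_factors) (use False assms(1,2) not_le in auto)
  moreover have "m \<noteq> 2" using assms(5) by (metis mult_1_right power_one)
  ultimately consider "m = 3" "n = 1" | "m = 3" "n = 2" | "m = 6" "n = 1" | "m = 6" "n = 5"
  proof -
    assume that: "m = 3 \<Longrightarrow> n = 1 \<Longrightarrow> thesis" "m = 3 \<Longrightarrow> n = 2 \<Longrightarrow> thesis"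
      "m = 6 \<Longrightarrow> n = 1 \<Longrightarrow> thesis" "m = 6 \<Longrightarrow> n = 5 \<Longrightarrow> thesis"
    have m: "m = 3 \<or> m = 6" using \<open>m \<in> {1, 2, 3, 6}\<close> \<open>m \<noteq> 2\<close> assms(1,2) by auto
    have cop: "\<not> k dvd n" if "k dvd m" "k \<noteq> 1" for k
      using coprime_common_divisor[OF assms(3) that(1)] that(2) by auto
    have "n \<noteq> 2 \<and> n \<noteq> 3 \<and> n \<noteq> 4" if "m = 6"
      using cop[of 2] cop[of 3] that by auto
    then show thesis using m that assms(1,2) by linarith
  qed
  \<comment> \<open>Apart from \<open>(3, 1)\<close>, the sums \<open>m + n\<close> are the primes
    5, 7 and 11.\<close>
  then show ?thesis
  proof cases
    case 1
    then show ?thesis using one_le_Z_rank_3_1 by simp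
  next
    case 2
    have "prime (5::nat)" by simp
    from one_le_Z_rank_of_dvd_right[OF this assms(1-3)] 2 show ?thesis by simp
  next
    case 3
    have "prime (7::nat)" by simp
    from one_le_Z_rank_of_dvd_right[OF this assms(1-3)] 3 show ?thesis by simp
  next
    case 4
    have "prime (11::nat)" by simp
    from one_le_Z_rank_of_dvd_right[OF this assms(1-3)] 4 show ?thesis by simp
  qed
qed

end
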